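(* For any set $\Gamma\cup\{\phi\}$ of $\mathbf{CPL}(\subseteq)$-formulas, $\Gamma\models\phi$ if and only if $\Gamma\vdash\phi$, where $\vdash$ is derivability in the natural deduction system of $\mathbf{CPL}(\subseteq)$.
   Context: Fix a set $\mathsf{Prop}$ of propositional variables. Classical formulas: $\alpha::=p\mid\bot\mid\top\mid\neg\alpha\mid(\alpha\wedge\alpha)\mid(\alpha\vee\alpha)$ with $p\in\mathsf{Prop}$. Formulas of $\mathbf{CPL}(\subseteq)$ (propositional inclusion logic): $\phi::=p\mid\bot\mid\top\mid\neg\alpha\mid\mathsf a\subseteq\mathsf b\mid(\phi\wedge\phi)\mid(\phi\vee\phi)$ with $\alpha$ classical and $\mathsf a\subseteq\mathsf b$ an inclusion atom: $\mathsf a=a_1\dots a_k$, $\mathsf b=b_1\dots b_k$ with $a_i,b_i\in\mathsf{Prop}\cup\{\bot,\top\}$ (empty sequences allowed). For classical $\alpha$, $\alpha\to\phi:=\neg\alpha\vee\phi$. For $\mathsf N\subseteq\mathsf{Prop}$, a valuation on $\mathsf N$ is a function $v:\mathsf N\cup\{\bot,\top\}\to\{0,1\}$ with $v(\bot)=0$, $v(\top)=1$; an $\mathsf N$-team is a set $X$ of valuations on $\mathsf N$, with $\mathsf{dom}(X)=\mathsf N$ (the empty set is a team of any domain); $v(a_1\dots a_k)=\langle v(a_1),\dots,v(a_k)\rangle$. Team semantics, for $X$ whose domain contains the variables of $\phi$: $X\models p$ iff $v(p)=1$ for all $v\in X$; $X\models\bot$ iff $X=\emptyset$; $X\models\top$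 always; $X\models\neg\alpha$ iff $\{v\}\not\models\alpha$ for all $v\in X$; $X\models\phi\wedge\psi$ iff $X\models\phi$ and $X\models\psi$; $X\models\phi\vee\psi$ iff there are $Y,Z\subseteq X$ with $X=Y\cup Z$, $Y\models\phi$, $Z\models\psi$; $X\models\mathsf a\subseteq\mathsf b$ iff for all $v\in X$ there is $u\in X$ with $v(\mathsf a)=u(\mathsf b)$. $\Gamma\models\phi$ means: every team whose domain contains all variables of $\Gamma\cup\{\phi\}$ and which satisfies every $\gamma\in\Gamma$ satisfies $\phi$. Notation: $p^\top:=p$, $p^\bot:=\neg p$, $\top^\top:=\top$, $\bot^\bot:=\neg\bot$, $\top^\bot:=\bot^\top:=\bot$; $\mathsf a^{\mathsf x}:=a_1^{x_1}\wedge\dots\wedge a_k^{x_k}$ ($\top$ if $k=0$) for $\mathsf x\in\{\top,\bot\}^k$; $|\mathsf a|$ is the length of $\mathsf a$. Natural deduction system of $\mathbf{CPL}(\subseteq)$: $\Gamma\vdash\phi$ means there is a derivation of $\phi$ all of whose undischarged assumptions lie in $\Gamma$. In sequent notation, $\vdash$ is the least relation such that $\Gamma\vdash\phi$ for $\phi\in\Gamma$, $\Gamma\vdash\phi$ implies $\Gamma\cup\Gamma'\vdash\phi$, and which is closed under the following rules, where $\alpha$ ranges over classical formulas, $\phi,\psi,\chi$ over formulas of $\mathbf{CPL}(\subseteq)$, $\Gamma$ over sets of formulas, $\Delta$ over sets of classical formulas only, $\mathsf a,\mathsf b,\mathsf c,\mathsf d,\mathsf a',\dots$ over possibly empty sequences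 of elements of $\mathsf{Prop}\cup\{\top,\bot\}$ of matching lengths, $\mathsf x,\mathsf x_i$ over sequences of constants $\top,\bot$, and $p$ over variables: - $\top$I: $\Gamma\vdash\top$. $\neg$I: from $\Delta,\alpha\vdash\bot$ infer $\Delta\vdash\neg\alpha$. RAA: from $\Delta,\neg\alpha\vdash\bot$ infer $\Delta\vdash\alpha$. $\neg$E: from $\Gamma\vdash\alpha$, $\Gamma\vdash\neg\alpha$ infer $\Gamma\vdash\phi$. - $\wedge$I: from $\Gamma\vdash\phi$, $\Gamma\vdash\psi$ infer $\Gamma\vdash\phi\wedge\psi$. $\wedge$E: from $\Gamma\vdash\phi\wedge\psi$ infer $\Gamma\vdash\phi$, and infer $\Gamma\vdash\psi$. - $\vee$I: from $\Gamma\vdash\phi$ infer $\Gamma\vdash\phi\vee\psi$, and infer $\Gamma\vdash\psi\vee\phi$. $\vee$E: from $\Gamma\vdash\phi\vee\psi$, $\Delta,\phi\vdash\chi$, $\Delta,\psi\vdash\chi$ infer $\Gamma\cup\Delta\vdash\chi$. - $\subseteq$Exc: from $\Gamma\vdash\mathsf{abc}\subseteq\mathsf{a'b'c'}$ infer $\Gamma\vdash\mathsf{bac}\subseteq\mathsf{b'a'c'}$. $\subseteq$Ctr: from $\Gamma\vdash\mathsf{ab}\subseteq\mathsf{cd}$ infer $\Gamma\vdash\mathsf a\subseteq\mathsf c$. $\subseteq$Wk: from $\Gamma\vdash\mathsf{ab}\subseteq\mathsf{cd}$ infer $\Gamma\vdash\mathsf{aab}\subseteq\mathsf{ccd}$ (with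 $|\mathsf a|=|\mathsf a'|$, $|\mathsf b|=|\mathsf b'|$, resp. $|\mathsf a|=|\mathsf c|$). - $\subseteq$Trs: from $\Gamma\vdash\mathsf a\subseteq\mathsf b$, $\Gamma\vdash\mathsf b\subseteq\mathsf c$ infer $\Gamma\vdash\mathsf a\subseteq\mathsf c$. $\subseteq$Id: $\Gamma\vdash\mathsf a\subseteq\mathsf a$. - $\subseteq$Cmp: from $\Gamma\vdash\mathsf a\subseteq\mathsf b$ and $\Gamma\vdash\alpha(\mathsf b)$ infer $\Gamma\vdash\alpha(\mathsf a)$; here $\alpha(\mathsf b)$ and $\alpha(\mathsf a)$ are obtained from a classical formula $\alpha(r_1,\dots,r_k)$ whose only atoms are placeholder variables $r_1,\dots,r_k$ by substituting $b_i$, respectively $a_i$, for $r_i$. - $\subseteq_0$Ext: from $\Gamma\vdash\mathsf a\subseteq\mathsf b$ infer $\Gamma\vdash\top\mathsf a\subseteq\top\mathsf b$, and infer $\Gamma\vdash\bot\mathsf a\subseteq\bot\mathsf b$; from $\Gamma\vdash p$, $\Gamma\vdash\mathsf a\subseteq\mathsf b$ infer $\Gamma\vdash\top\mathsf a\subseteq p\mathsf b$; from $\Gamma\vdash\neg p$, $\Gamma\vdash\mathsf a\subseteq\mathsf b$ infer $\Gamma\vdash\bot\mathsf a\subseteq p\mathsf b$. - $\vee_{\subseteq_0}$E: from $\Gamma\vdash(\phi\wedge\mathsf x\subseteq\mathsf a)\vee\psi$, $\Gamma,\phi,\mathsf x\subseteq\mathsf a\vdash\chi$, $\Gamma,\psi\vdash\chi$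 and $\Gamma,\phi\vee\psi,\mathsf x\subseteq\mathsf a\vdash\chi$ infer $\Gamma\vdash\chi$. - $\subseteq_0$Dst: from $\Gamma\vdash\phi\vee\psi$ and $\Gamma\vdash\mathsf x_i\subseteq\mathsf a_i$ for $i=1,\dots,k$ infer $\Gamma\vdash\big((\phi\vee\mathsf a_1^{\mathsf x_1}\vee\dots\vee\mathsf a_k^{\mathsf x_k})\wedge\mathsf x_1\subseteq\mathsf a_1\wedge\dots\wedge\mathsf x_k\subseteq\mathsf a_k\big)\vee\psi$. - $\subseteq$Ext: from $\Gamma\vdash\bigwedge_{\mathsf x\in\{\top,\bot\}^{|\mathsf a|}}(\mathsf a^{\mathsf x}\to\mathsf x\subseteq\mathsf b)$ infer $\Gamma\vdash\mathsf a\subseteq\mathsf b$. - $\subseteq$Rdt: from $\Gamma\vdash\mathsf a\subseteq\mathsf b$ infer $\Gamma\vdash\mathsf a^{\mathsf x}\to\mathsf x\subseteq\mathsf b$, for any $\mathsf x\in\{\top,\bot\}^{|\mathsf a|}$. *)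

theory Defs
  imports Main "HOL-Library.FuncSet"
begin

section \<open>Syntax\<close>

text \<open>Elements of \<open>Prop \<union> {\<bottom>, \<top>}\<close>; the type parameter is \<open>Prop\<close>.\<close>

datatype 'p atom = PVar 'p | Bot | Top

text \<open>
  Classical formulas are the instances \<open>'p atom cform\<close>. The atoms are a type parameter
  so that \<open>nat cform\<close> can serve as the type of schematic formulas \<open>\<alpha>(r\<^sub>1,\<dots>,r\<^sub>k)\<close> whose only
  atoms are placeholders; substitution for the placeholders is then \<open>map_cform\<close>.
\<close>

datatype (catoms: 'a) cform =
    CAtom 'a
  | CNeg "'a cform"
  | CAnd "'a cform" "'a cform"
  | COr "'a cform" "'a cform"

type_synonym 'p classical = "'p atom cform"

text \<open>
  Formulas of \<open>CPL(\<subseteq>)\<close>. An inclusion atom \<open>a\<^sub>1\<dots>a\<^sub>k \<subseteq> b\<^sub>1\<dots>b\<^sub>k\<close> is stored as the list of pairs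
  \<open>(a\<^sub>i, b\<^sub>i)\<close>, so that both sides have the same length by construction.
  The generated set function \<open>vars\<close> yields all variables occurring in a formula,
  including those below \<open>Neg\<close> and in inclusion atoms.
\<close>

datatype (vars: 'p) form =
    Atom "'p atom"
  | Neg "'p classical"
  | Incl "('p atom \<times> 'p atom) list"
  | And "'p form" "'p form"
  | Or "'p form" "'p form"

text \<open>Only meaningful when both sequences have the same length (\<open>zip\<close> truncates).\<close>

abbreviation incl :: "'p atom list \<Rightarrow> 'p atom list \<Rightarrow> 'p form" (infix "\<sqsubseteq>" 55) where
  "a \<sqsubseteq> b \<equiv> Incl (zip a b)"

text \<open>The inclusion of the classical formulas in the formulas of \<open>CPL(\<subseteq>)\<close>.\<close>

primrec emb :: "'p classical \<Rightarrow> 'p form" where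
  "emb (CAtom a) = Atom a"
| "emb (CNeg \<alpha>) = Neg \<alpha>"
| "emb (CAnd \<alpha> \<beta>) = And (emb \<alpha>) (emb \<beta>)"
| "emb (COr \<alpha> \<beta>) = Or (emb \<alpha>) (emb \<beta>)"

lemma inj_emb: "inj emb"
proof (rule injI)
  fix \<alpha> \<beta> :: "'p classical"
  show "emb \<alpha> = emb \<beta> \<Longrightarrow> \<alpha> = \<beta>"
  proof (induction \<alpha> arbitrary: \<beta>)
    case (CAtom a) then show ?case by (cases \<beta>) auto
  next
    case (CNeg \<alpha>) then show ?case by (cases \<beta>) auto
  next
    case (CAnd \<alpha>1 \<alpha>2) then show ?case by (cases \<beta>) auto
  next
    case (COr \<alpha>1 \<alpha>2) then show ?case by (cases \<beta>) auto
  qed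
qed

definition Imp :: "'p classical \<Rightarrow> 'p form \<Rightarrow> 'p form" where
  "Imp \<alpha> \<phi> = Or (Neg \<alpha>) \<phi>"

text \<open>
  Sequences of constants are represented by Boolean lists, \<open>True\<close> standing for \<open>\<top>\<close>;
  \<open>consts_of x\<close> is the corresponding sequence over \<open>{\<top>, \<bottom>}\<close>.
\<close>

definition consts_of :: "bool list \<Rightarrow> 'p atom list" where
  "consts_of x = map (\<lambda>c. if c then Top else Bot) x"

fun literal :: "'p atom \<Rightarrow> bool \<Rightarrow> 'p classical" where
  "literal (PVar p) True = CAtom (PVar p)"
| "literal (PVar p) False = CNeg (CAtom (PVar p))"
| "literal Top True = CAtom Top"
| "literal Top False = CAtom Bot"
| "literal Bot True = CAtom Bot"
| "literal Bot False = CNeg (CAtom Bot)"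

text \<open>Iterated connectives associate to the left.\<close>

fun CConj :: "'p classical list \<Rightarrow> 'p classical" where
  "CConj [] = CAtom Top"
| "CConj (\<alpha> # \<alpha>s) = foldl CAnd \<alpha> \<alpha>s"

fun Conj :: "'p form list \<Rightarrow> 'p form" where
  "Conj [] = Atom Top"
| "Conj (\<phi> # \<phi>s) = foldl And \<phi> \<phi>s"

text \<open>The formula \<open>a\<^sup>x\<close>, for sequences \<open>a\<close> and \<open>x\<close> of the same length.\<close>

definition seq_power :: "'p atom list \<Rightarrow> bool list \<Rightarrow> 'p classical" where
  "seq_power a x = CConj (map2 literal a x)"


section \<open>Team semantics\<close>

text \<open>
  A valuation on \<open>N\<close> is an element of \<open>N \<rightarrow>\<^sub>E UNIV\<close>, i.e. it has a fixed dummy value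
  outside \<open>N\<close>; the values of the constants are supplied by \<open>val\<close>.
\<close>

primrec val :: "('p \<Rightarrow> bool) \<Rightarrow> 'p atom \<Rightarrow> bool" where
  "val v (PVar p) = v p"
| "val v Bot = False"
| "val v Top = True"

definition team :: "'p set \<Rightarrow> ('p \<Rightarrow> bool) set \<Rightarrow> bool" where
  "team N X \<longleftrightarrow> X \<subseteq> (N \<rightarrow>\<^sub>E UNIV)"

lemma size_emb [termination_simp]: "size (emb \<alpha>) < Suc (size_cform size \<alpha>)"
  by (induction \<alpha>) auto

fun sat :: "('p \<Rightarrow> bool) set \<Rightarrow> 'p form \<Rightarrow> bool" (infix "\<Turnstile>" 50) where
  "X \<Turnstile> Atom (PVar p) \<longleftrightarrow> (\<forall>v\<in>X. v p)"
| "X \<Turnstile> Atom Bot \<longleftrightarrow> X = {}"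
| "X \<Turnstile> Atom Top \<longleftrightarrow> True"
| "X \<Turnstile> Neg \<alpha> \<longleftrightarrow> (\<forall>v\<in>X. \<not> {v} \<Turnstile> emb \<alpha>)"
| "X \<Turnstile> And \<phi> \<psi> \<longleftrightarrow> X \<Turnstile> \<phi> \<and> X \<Turnstile> \<psi>"
| "X \<Turnstile> Or \<phi> \<psi> \<longleftrightarrow> (\<exists>Y Z. Y \<subseteq> X \<and> Z \<subseteq> X \<and> X = Y \<union> Z \<and> Y \<Turnstile> \<phi> \<and> Z \<Turnstile> \<psi>)"
| "X \<Turnstile> Incl ps \<longleftrightarrow>
     (\<forall>v\<in>X. \<exists>u\<in>X. map (val v) (map fst ps) = map (val u) (map snd ps))"

definition entails :: "'p form set \<Rightarrow> 'p form \<Rightarrow> bool" (infix "\<TTurnstile>" 50) where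
  "\<Gamma> \<TTurnstile> \<phi> \<longleftrightarrow>
    (\<forall>N X. team N X \<longrightarrow> (\<Union>\<gamma>\<in>\<Gamma> \<union> {\<phi>}. vars \<gamma>) \<subseteq> N \<longrightarrow> (\<forall>\<gamma>\<in>\<Gamma>. X \<Turnstile> \<gamma>) \<longrightarrow> X \<Turnstile> \<phi>)"


section \<open>Natural deduction\<close>

text \<open>
  A set of classical formulas only is written \<open>emb ` \<Delta>\<close>.
  In \<open>Incl0Dst\<close>, the list \<open>xas\<close> consists of the pairs \<open>(x\<^sub>i, a\<^sub>i)\<close>.
  In \<open>InclExt\<close>, \<open>List.n_lists k [True, False]\<close> enumerates the constant sequences of length \<open>k\<close>.
\<close>

inductive deriv :: "'p form set \<Rightarrow> 'p form \<Rightarrow> bool" (infix "\<turnstile>" 50) where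
  Assm: "\<phi> \<in> \<Gamma> \<Longrightarrow> \<Gamma> \<turnstile> \<phi>"
| Weaken: "\<Gamma> \<turnstile> \<phi> \<Longrightarrow> \<Gamma> \<union> \<Gamma>' \<turnstile> \<phi>"
| TopI: "\<Gamma> \<turnstile> Atom Top"
| NegI: "emb ` \<Delta> \<union> {emb \<alpha>} \<turnstile> Atom Bot \<Longrightarrow> emb ` \<Delta> \<turnstile> Neg \<alpha>"
| RAA: "emb ` \<Delta> \<union> {Neg \<alpha>} \<turnstile> Atom Bot \<Longrightarrow> emb ` \<Delta> \<turnstile> emb \<alpha>"
| NegE: "\<lbrakk>\<Gamma> \<turnstile> emb \<alpha>; \<Gamma> \<turnstile> Neg \<alpha>\<rbrakk> \<Longrightarrow> \<Gamma> \<turnstile> \<phi>"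
| AndI: "\<lbrakk>\<Gamma> \<turnstile> \<phi>; \<Gamma> \<turnstile> \<psi>\<rbrakk> \<Longrightarrow> \<Gamma> \<turnstile> And \<phi> \<psi>"
| AndE1: "\<Gamma> \<turnstile> And \<phi> \<psi> \<Longrightarrow> \<Gamma> \<turnstile> \<phi>"
| AndE2: "\<Gamma> \<turnstile> And \<phi> \<psi> \<Longrightarrow> \<Gamma> \<turnstile> \<psi>"
| OrI1: "\<Gamma> \<turnstile> \<phi> \<Longrightarrow> \<Gamma> \<turnstile> Or \<phi> \<psi>"
| OrI2: "\<Gamma> \<turnstile> \<phi> \<Longrightarrow> \<Gamma> \<turnstile> Or \<psi> \<phi>"
| OrE: "\<lbrakk>\<Gamma> \<turnstile> Or \<phi> \<psi>; emb ` \<Delta> \<union> {\<phi>} \<turnstile> \<chi>; emb ` \<Delta> \<union> {\<psi>} \<turnstile> \<chi>\<rbrakk> \<Longrightarrow> \<Gamma> \<union> emb ` \<Delta> \<turnstile> \<chi>"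
| InclExc: "\<lbrakk>length a = length a'; length b = length b'; length c = length c';
    \<Gamma> \<turnstile> a @ b @ c \<sqsubseteq> a' @ b' @ c'\<rbrakk> \<Longrightarrow> \<Gamma> \<turnstile> b @ a @ c \<sqsubseteq> b' @ a' @ c'"
| InclCtr: "\<lbrakk>length a = length c; length b = length d;
    \<Gamma> \<turnstile> a @ b \<sqsubseteq> c @ d\<rbrakk> \<Longrightarrow> \<Gamma> \<turnstile> a \<sqsubseteq> c"
| InclWk: "\<lbrakk>length a = length c; length b = length d;
    \<Gamma> \<turnstile> a @ b \<sqsubseteq> c @ d\<rbrakk> \<Longrightarrow> \<Gamma> \<turnstile> a @ a @ b \<sqsubseteq> c @ c @ d"
| InclTrs: "\<lbrakk>length a = length b; length b = length c;
    \<Gamma> \<turnstile> a \<sqsubseteq> b; \<Gamma> \<turnstile> b \<sqsubseteq> c\<rbrakk> \<Longrightarrow> \<Gamma> \<turnstile> a \<sqsubseteq> c"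
| InclId: "\<Gamma> \<turnstile> a \<sqsubseteq> a"
| InclCmp: "\<lbrakk>length a = length b; catoms \<alpha> \<subseteq> {..<length b};
    \<Gamma> \<turnstile> a \<sqsubseteq> b; \<Gamma> \<turnstile> emb (map_cform (\<lambda>i. b ! i) \<alpha>)\<rbrakk>
    \<Longrightarrow> \<Gamma> \<turnstile> emb (map_cform (\<lambda>i. a ! i) \<alpha>)"
| Incl0ExtTop: "\<lbrakk>length a = length b; \<Gamma> \<turnstile> a \<sqsubseteq> b\<rbrakk> \<Longrightarrow> \<Gamma> \<turnstile> Top # a \<sqsubseteq> Top # b"
| Incl0ExtBot: "\<lbrakk>length a = length b; \<Gamma> \<turnstile> a \<sqsubseteq> b\<rbrakk> \<Longrightarrow> \<Gamma> \<turnstile> Bot # a \<sqsubseteq> Bot # b"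
| Incl0ExtPos: "\<lbrakk>length a = length b; \<Gamma> \<turnstile> Atom (PVar p); \<Gamma> \<turnstile> a \<sqsubseteq> b\<rbrakk>
    \<Longrightarrow> \<Gamma> \<turnstile> Top # a \<sqsubseteq> PVar p # b"
| Incl0ExtNeg: "\<lbrakk>length a = length b; \<Gamma> \<turnstile> Neg (CAtom (PVar p)); \<Gamma> \<turnstile> a \<sqsubseteq> b\<rbrakk>
    \<Longrightarrow> \<Gamma> \<turnstile> Bot # a \<sqsubseteq> PVar p # b"
| OrIncl0E: "\<lbrakk>length x = length a;
    \<Gamma> \<turnstile> Or (And \<phi> (consts_of x \<sqsubseteq> a)) \<psi>;
    \<Gamma> \<union> {\<phi>, consts_of x \<sqsubseteq> a} \<turnstile> \<chi>;
    \<Gamma> \<union> {\<psi>} \<turnstile> \<chi>;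
    \<Gamma> \<union> {Or \<phi> \<psi>, consts_of x \<sqsubseteq> a} \<turnstile> \<chi>\<rbrakk> \<Longrightarrow> \<Gamma> \<turnstile> \<chi>"
| Incl0Dst: "\<lbrakk>\<And>x a. (x, a) \<in> set xas \<Longrightarrow> length x = length a;
    \<Gamma> \<turnstile> Or \<phi> \<psi>;
    \<And>x a. (x, a) \<in> set xas \<Longrightarrow> \<Gamma> \<turnstile> consts_of x \<sqsubseteq> a\<rbrakk>
    \<Longrightarrow> \<Gamma> \<turnstile> Or
          (foldl And
            (foldl Or \<phi> (map (\<lambda>(x, a). emb (seq_power a x)) xas))
            (map (\<lambda>(x, a). consts_of x \<sqsubseteq> a) xas))
          \<psi>"
| InclExt: "\<lbrakk>length a = length b;
    \<Gamma> \<turnstile> Conj (map (\<lambda>x. Imp (seq_power a x) (consts_of x \<sqsubseteq> b))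
          (List.n_lists (length a) [True, False]))\<rbrakk> \<Longrightarrow> \<Gamma> \<turnstile> a \<sqsubseteq> b"
| InclRdt: "\<lbrakk>length a = length b; length x = length a; \<Gamma> \<turnstile> a \<sqsubseteq> b\<rbrakk>
    \<Longrightarrow> \<Gamma> \<turnstile> Imp (seq_power a x) (consts_of x \<sqsubseteq> b)"

end

theory Submission
  imports Defs
begin

text \<open>
  Soundness is an induction on derivations. Classical formulas are flat (\<open>sat_emb\<close>), which
  justifies the rules with classical contexts, and all formulas hold in the empty team and are
  closed under unions of teams (\<open>sat_empty\<close>, \<open>sat_Union\<close>), which justifies the rules for \<open>\<or>\<close>.
  Valuations on a domain \<open>N\<close> are particular total functions, so both directions can be
  proved for arbitrary sets of total functions, without any mention of domains.

  For completeness, fix a finite list \<open>ps\<close> of distinct variables. A team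
  restricted to \<open>ps\<close> is a finite set of \<^emph>\<open>rows\<close>, and it is described up to the empty team by a single formula \<open>team_char\<close>: the classical
  disjunction of its rows together with the inclusion atoms \<open>x \<subseteq> ps\<close>, for its rows \<open>x\<close>. Let \<open>X\<close> be a
  team with characteristic formula \<open>\<theta>\<close>, and \<open>\<psi>\<close> a formula over \<open>ps\<close>. If \<open>X \<Turnstile> \<psi>\<close> then \<open>{\<theta>} \<turnstile> \<psi>\<close>
  (\<open>team_char_complete\<close>), and otherwise \<open>{\<theta>, \<psi>} \<turnstile> \<bottom>\<close> (\<open>team_char_refute\<close>). So \<open>\<theta>\<close> decides every
  formula over \<open>ps\<close>.

  The calculus cannot say that a row is missing by negating an inclusion atom, but the classical
  formula \<open>\<not> ps\<^sup>x\<close> says it. The rule \<open>\<or>\<^sub>\<subseteq>\<^sub>0E\<close>, applied to excluded middle for \<open>ps\<^sup>x\<close>, yields the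
  case distinction between \<open>x \<subseteq> ps\<close> and \<open>\<not> ps\<^sup>x\<close> in an arbitrary context (\<open>row_split\<close>). Hence, if
  \<open>\<Gamma>\<close> does not derive \<open>\<phi>\<close>, a maximal extension \<open>M\<close> of \<open>\<Gamma>\<close> with the same property decides all
  rows over all \<open>ps\<close>. Let \<open>X\<close> be the set of all valuations that satisfy the classical formulas in
  \<open>M\<close>. Then \<open>M\<close> derives the characteristic formula of \<open>X\<close> over every \<open>ps\<close>: a row decided positively
  is consistent with the classical part of \<open>M\<close>, and by classical completeness some valuation in \<open>X\<close>
  has this row. The two facts about \<open>team_char\<close> now give \<open>X \<Turnstile> \<gamma>\<close> for all \<open>\<gamma> \<in> \<Gamma>\<close>, and \<open>\<not> X \<Turnstile> \<phi>\<close>.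
  Since \<open>M\<close> need not be finite, this also handles infinite \<open>\<Gamma>\<close>.

  Some care is needed with cut. Three rules require classical contexts, so
  derivations cannot simply be composed. Cut is admissible nevertheless (\<open>cut\<close>): it is immediate
  when the classical members of the cut context follow from classical assumptions alone, and a
  case distinction over the rows of a team reduces the general case to this one.
\<close>

section \<open>Flatness and soundness\<close>

text \<open>
  Flatness reduces classical formulas to this evaluation. The atoms are arbitrary so that it also
  applies to schematic formulas, whose atoms are placeholders or pairs of atoms.
\<close>

primrec ceval :: "('a \<Rightarrow> bool) \<Rightarrow> 'a cform \<Rightarrow> bool" where
  "ceval f (CAtom a) = f a"
| "ceval f (CNeg \<alpha>) = (\<not> ceval f \<alpha>)"
| "ceval f (CAnd \<alpha> \<beta>) = (ceval f \<alpha> \<and> ceval f \<beta>)"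
| "ceval f (COr \<alpha> \<beta>) = (ceval f \<alpha> \<or> ceval f \<beta>)"

lemma ceval_map_cform: "ceval f (map_cform g \<alpha>) = ceval (\<lambda>a. f (g a)) \<alpha>"
  by (induction \<alpha>) auto

lemma ceval_cong: "(\<And>a. a \<in> catoms \<alpha> \<Longrightarrow> f a = g a) \<Longrightarrow> ceval f \<alpha> = ceval g \<alpha>"
  by (induction \<alpha>) auto

lemma sat_emb: "X \<Turnstile> emb \<alpha> \<longleftrightarrow> (\<forall>v\<in>X. ceval (val v) \<alpha>)"
proof (induction \<alpha> arbitrary: X)
  case (CAtom a) then show ?case by (cases a) auto
next
  case (COr \<alpha> \<beta>)
  have "(\<exists>Y Z. Y \<subseteq> X \<and> Z \<subseteq> X \<and> X = Y \<union> Z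
      \<and> (\<forall>v\<in>Y. ceval (val v) \<alpha>) \<and> (\<forall>v\<in>Z. ceval (val v) \<beta>))"
    if "\<forall>v\<in>X. ceval (val v) \<alpha> \<or> ceval (val v) \<beta>"
    using that by (intro exI[of _ "{v\<in>X. ceval (val v) \<alpha>}"] exI[of _ "{v\<in>X. ceval (val v) \<beta>}"]) auto
  with COr show ?case by auto
qed auto

lemma sat_empty: "{} \<Turnstile> \<phi>"
proof (induction \<phi>)
  case (Atom a) then show ?case by (cases a) auto
qed auto

text \<open>
  Union closure is what makes \<open>\<or>E\<close> sound: both parts of the split team satisfy the conclusion,
  hence so does the whole.
\<close>

lemma sat_Union: "\<forall>Y\<in>\<Y>. Y \<Turnstile> \<phi> \<Longrightarrow> \<Union>\<Y> \<Turnstile> \<phi>"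
proof (induction \<phi> arbitrary: \<Y>)
  case (Atom a) then show ?case by (cases a) auto
next
  case (Or \<phi> \<psi>)
  then obtain f g where fg: "\<forall>Y\<in>\<Y>. Y = f Y \<union> g Y \<and> f Y \<Turnstile> \<phi> \<and> g Y \<Turnstile> \<psi>"
    by simp metis
  then have "\<Union>(f ` \<Y>) \<Turnstile> \<phi>" "\<Union>(g ` \<Y>) \<Turnstile> \<psi>"
    using Or.IH(1)[of "f ` \<Y>"] Or.IH(2)[of "g ` \<Y>"] by auto
  moreover have "\<Union>\<Y> = \<Union>(f ` \<Y>) \<union> \<Union>(g ` \<Y>)"
    using fg by blast
  ultimately show ?case by auto
next
  case (Incl ps) then show ?case by (simp add: Bex_def) blast
qed auto

lemma ceval_literal: "ceval (val v) (literal a x) \<longleftrightarrow> val v a = x"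
  by (cases "(a, x)" rule: literal.cases) auto

lemma ceval_foldl_CAnd:
  "ceval f (foldl CAnd \<alpha> \<alpha>s) \<longleftrightarrow> ceval f \<alpha> \<and> (\<forall>\<beta>\<in>set \<alpha>s. ceval f \<beta>)"
  by (induction \<alpha>s arbitrary: \<alpha>) auto

lemma ceval_CConj: "ceval (val v) (CConj \<alpha>s) \<longleftrightarrow> (\<forall>\<beta>\<in>set \<alpha>s. ceval (val v) \<beta>)"
  by (cases \<alpha>s) (auto simp: ceval_foldl_CAnd)

lemma ceval_seq_power:
  "length a = length x \<Longrightarrow> ceval (val v) (seq_power a x) \<longleftrightarrow> map (val v) a = x"
  unfolding seq_power_def ceval_CConj
  by (induction a x rule: list_induct2) (auto simp: ceval_literal)

lemma map_val_consts_of [simp]: "map (val v) (consts_of x) = x"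
  unfolding consts_of_def by (induction x) auto

lemma length_consts_of [simp]: "length (consts_of x) = length x"
  by (simp add: consts_of_def)

lemma sat_incl:
  "length a = length b \<Longrightarrow> X \<Turnstile> a \<sqsubseteq> b \<longleftrightarrow> (\<forall>v\<in>X. \<exists>u\<in>X. map (val v) a = map (val u) b)"
  by simp

lemma sat_foldl_And: "X \<Turnstile> foldl And \<phi> \<phi>s \<longleftrightarrow> X \<Turnstile> \<phi> \<and> (\<forall>\<psi>\<in>set \<phi>s. X \<Turnstile> \<psi>)"
  by (induction \<phi>s arbitrary: \<phi>) auto

lemma sat_Conj: "X \<Turnstile> Conj \<phi>s \<longleftrightarrow> (\<forall>\<psi>\<in>set \<phi>s. X \<Turnstile> \<psi>)"
  by (cases \<phi>s) (auto simp: sat_foldl_And)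

lemma sat_OrI: "Y \<Turnstile> \<phi> \<Longrightarrow> Z \<Turnstile> \<psi> \<Longrightarrow> Y \<union> Z \<Turnstile> Or \<phi> \<psi>"
  by auto

text \<open>
  Soundness of \<open>\<subseteq>\<^sub>0Dst\<close> enlarges the left part of a split by all valuations \<open>v\<close> with \<open>v(a\<^sub>i) = x\<^sub>i\<close>;
  these are the members of \<open>Z\<close> here.
\<close>

lemma sat_foldl_Or:
  "\<lbrakk>Y \<Turnstile> \<phi>; \<forall>v\<in>Z. \<exists>\<alpha>\<in>set \<alpha>s. ceval (val v) \<alpha>\<rbrakk> \<Longrightarrow> Y \<union> Z \<Turnstile> foldl Or \<phi> (map emb \<alpha>s)"
proof (induction \<alpha>s arbitrary: Y Z \<phi>)
  case Nil then show ?case by auto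
next
  case (Cons \<alpha> \<alpha>s)
  let ?A = "{v\<in>Z. ceval (val v) \<alpha>}"
  have "Y \<union> ?A \<Turnstile> Or \<phi> (emb \<alpha>)"
    using Cons.prems(1) by (intro sat_OrI) (auto simp: sat_emb)
  then have "(Y \<union> ?A) \<union> (Z - ?A) \<Turnstile> foldl Or (Or \<phi> (emb \<alpha>)) (map emb \<alpha>s)"
    using Cons.prems(2) by (intro Cons.IH) auto
  moreover have "(Y \<union> ?A) \<union> (Z - ?A) = Y \<union> Z" by auto
  ultimately show ?case by simp
qed

lemma set_n_lists_bool: "set (List.n_lists n [True, False]) = {x. length x = n}"
  by (auto simp: set_n_lists)

text \<open>
  An implication need not be witnessed by exactly the valuations that satisfy the antecedent:
  a larger subteam may be required to supply the witnesses for \<open>\<phi>\<close>.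
\<close>

lemma sat_Imp:
  assumes "length a = length x"
  shows "X \<Turnstile> Imp (seq_power a x) \<phi> \<longleftrightarrow>
    (\<exists>Z\<subseteq>X. Z \<Turnstile> \<phi> \<and> (\<forall>v\<in>X. map (val v) a = x \<longrightarrow> v \<in> Z))"
proof
  assume "X \<Turnstile> Imp (seq_power a x) \<phi>"
  then show "\<exists>Z\<subseteq>X. Z \<Turnstile> \<phi> \<and> (\<forall>v\<in>X. map (val v) a = x \<longrightarrow> v \<in> Z)"
    using assms unfolding Imp_def by (auto simp: sat_emb ceval_seq_power)
next
  assume "\<exists>Z\<subseteq>X. Z \<Turnstile> \<phi> \<and> (\<forall>v\<in>X. map (val v) a = x \<longrightarrow> v \<in> Z)"
  then obtain Z where Z: "Z \<subseteq> X" "Z \<Turnstile> \<phi>" "\<forall>v\<in>X. map (val v) a = x \<longrightarrow> v \<in> Z" by blast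
  then have "X - Z \<union> Z \<Turnstile> Imp (seq_power a x) \<phi>"
    unfolding Imp_def using assms by (intro sat_OrI) (auto simp: sat_emb ceval_seq_power)
  moreover have "X - Z \<union> Z = X" using Z by auto
  ultimately show "X \<Turnstile> Imp (seq_power a x) \<phi>" by simp
qed

theorem soundness: "\<Gamma> \<turnstile> \<phi> \<Longrightarrow> \<forall>\<gamma>\<in>\<Gamma>. X \<Turnstile> \<gamma> \<Longrightarrow> X \<Turnstile> \<phi>"
proof (induction arbitrary: X rule: deriv.induct)
  case (NegI \<Delta> \<alpha>)
  have "\<not> ceval (val v) \<alpha>" if "v \<in> X" for v
    using NegI.IH[of "{v}"] NegI.prems that by (auto simp: sat_emb)
  then show ?case by (simp add: sat_emb)
next
  case (RAA \<Delta> \<alpha>)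
  have "ceval (val v) \<alpha>" if "v \<in> X" for v
    using RAA.IH[of "{v}"] RAA.prems that by (auto simp: sat_emb)
  then show ?case by (simp add: sat_emb)
next
  case (NegE \<Gamma> \<alpha> \<phi>)
  then have "X \<Turnstile> emb \<alpha>" "X \<Turnstile> Neg \<alpha>" by auto
  then have "X = {}" by (auto simp: sat_emb)
  then show ?case using sat_empty by auto
next
  case (OrI1 \<Gamma> \<phi> \<psi>)
  then have "X \<union> {} \<Turnstile> Or \<phi> \<psi>" by (intro sat_OrI sat_empty) auto
  then show ?case by simp
next
  case (OrI2 \<Gamma> \<phi> \<psi>)
  then have "{} \<union> X \<Turnstile> Or \<psi> \<phi>" by (intro sat_OrI sat_empty) auto
  then show ?case by simp
next
  case (OrE \<Gamma> \<phi> \<psi> \<Delta> \<chi>)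
  then have "X \<Turnstile> Or \<phi> \<psi>" by auto
  then obtain Y Z where YZ: "X = Y \<union> Z" "Y \<Turnstile> \<phi>" "Z \<Turnstile> \<psi>" by auto
  have "\<forall>v\<in>X. ceval (val v) \<alpha>" if "\<alpha> \<in> \<Delta>" for \<alpha>
    using that OrE.prems sat_emb by blast
  then have "Y \<Turnstile> \<chi>" "Z \<Turnstile> \<chi>"
    using OrE.IH(2)[of Y] OrE.IH(3)[of Z] YZ by (auto simp: sat_emb)
  then have "\<Union>{Y, Z} \<Turnstile> \<chi>" by (intro sat_Union) auto
  then show ?case using YZ(1) by simp
next
  case (InclExc a a' b b' c c' \<Gamma>)
  then show ?case by (simp add: sat_incl) blast
next
  case (InclCtr a c b d \<Gamma>)
  then show ?case by (simp add: sat_incl) blast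
next
  case (InclWk a c b d \<Gamma>)
  then show ?case by (simp add: sat_incl)
next
  case (InclTrs a b c \<Gamma>)
  then show ?case by (simp add: sat_incl) metis
next
  case (InclCmp a b \<alpha> \<Gamma>)
  have "ceval (val v) (map_cform (\<lambda>i. a ! i) \<alpha>)" if v: "v \<in> X" for v
  proof -
    have "X \<Turnstile> a \<sqsubseteq> b" using InclCmp.IH(1) InclCmp.prems by blast
    then obtain u where u: "u \<in> X" "map (val v) a = map (val u) b"
      using v unfolding sat_incl[OF InclCmp.hyps(1)] by blast
    have "val v (a ! i) = val u (b ! i)" if "i \<in> catoms \<alpha>" for i
      using that InclCmp.hyps u(2) by (metis lessThan_iff nth_map subsetD)
    then have "ceval (val v) (map_cform (\<lambda>i. a ! i) \<alpha>) = ceval (val u) (map_cform (\<lambda>i. b ! i) \<alpha>)"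
      unfolding ceval_map_cform by (rule ceval_cong)
    then show ?thesis using InclCmp u by (simp add: sat_emb)
  qed
  then show ?case by (simp add: sat_emb)
next
  case (Incl0ExtTop a b \<Gamma>) then show ?case by (simp add: sat_incl)
next
  case (Incl0ExtBot a b \<Gamma>) then show ?case by (simp add: sat_incl)
next
  case (Incl0ExtPos a b \<Gamma> p) then show ?case by (simp add: sat_incl) metis
next
  case (Incl0ExtNeg a b \<Gamma> p) then show ?case by (simp add: sat_incl) metis
next
  case (OrIncl0E x a \<Gamma> \<phi> \<psi> \<chi>)
  then have "X \<Turnstile> Or (And \<phi> (consts_of x \<sqsubseteq> a)) \<psi>" by blast
  then obtain Y Z where YZ: "X = Y \<union> Z" "Y \<Turnstile> And \<phi> (consts_of x \<sqsubseteq> a)" "Z \<Turnstile> \<psi>"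
    unfolding sat.simps(6) by blast
  \<comment> \<open>An inclusion atom true in a nonempty part is true in the whole team, because \<open>x\<close> is constant.\<close>
  show ?case
  proof (cases "Y = {}")
    case True
    then show ?thesis using OrIncl0E.IH(3) OrIncl0E.prems YZ by auto
  next
    case False
    have "X \<Turnstile> Or \<phi> \<psi>" using YZ by auto
    moreover have "X \<Turnstile> consts_of x \<sqsubseteq> a"
      using False YZ OrIncl0E.hyps by (auto simp: sat_incl)
    ultimately show ?thesis using OrIncl0E.IH(4) OrIncl0E.prems by auto
  qed
next
  case (Incl0Dst xas \<Gamma> \<phi> \<psi>)
  let ?\<alpha>s = "map (\<lambda>(x, a). seq_power a x) xas"
  let ?A = "{v\<in>X. \<exists>(x, a)\<in>set xas. map (val v) a = x}"
  from Incl0Dst have "X \<Turnstile> Or \<phi> \<psi>" by blast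
  then obtain Y Z where YZ: "X = Y \<union> Z" "Y \<Turnstile> \<phi>" "Z \<Turnstile> \<psi>" by auto
  have eq: "map emb ?\<alpha>s = map (\<lambda>(x, a). emb (seq_power a x)) xas" by auto
  have "Y \<union> ?A \<Turnstile> foldl Or \<phi> (map (\<lambda>(x, a). emb (seq_power a x)) xas)"
    unfolding eq[symmetric] using YZ Incl0Dst.hyps(1) by (intro sat_foldl_Or) (force simp: ceval_seq_power)+
  moreover have "Y \<union> ?A \<Turnstile> consts_of x \<sqsubseteq> a" if xa: "(x, a) \<in> set xas" for x a
  proof -
    have l: "length x = length a" using Incl0Dst.hyps(1) xa by blast
    have "X \<Turnstile> consts_of x \<sqsubseteq> a" using Incl0Dst.IH(2)[OF xa] Incl0Dst.prems by blast
    then have "\<exists>u\<in>X. map (val u) a = x" if "X \<noteq> {}"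
      using that l by (auto simp: sat_incl)
    then have "\<exists>u\<in>?A. map (val u) a = x" if "X \<noteq> {}"
      using that xa by blast
    then show ?thesis using l YZ(1) by (auto simp: sat_incl) 
  qed
  ultimately have "Y \<union> ?A \<Turnstile> foldl And (foldl Or \<phi> (map (\<lambda>(x, a). emb (seq_power a x)) xas))
      (map (\<lambda>(x, a). consts_of x \<sqsubseteq> a) xas)"
    by (auto simp: sat_foldl_And simp del: sat.simps)
  note sat_OrI[OF this YZ(3)]
  moreover have "Y \<union> ?A \<union> Z = X" using YZ(1) by auto
  ultimately show ?case by (simp del: sat.simps)
next
  case (InclExt a b \<Gamma>)
  have all: "\<exists>Z\<subseteq>X. Z \<Turnstile> consts_of x \<sqsubseteq> b \<and> (\<forall>v\<in>X. map (val v) a = x \<longrightarrow> v \<in> Z)"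
    if "length x = length a" for x
    using InclExt.IH[OF InclExt.prems] that by (auto simp: sat_Conj set_n_lists_bool sat_Imp)
  have "\<exists>u\<in>X. map (val v) a = map (val u) b" if v: "v \<in> X" for v
  proof -
    from all[of "map (val v) a"] v obtain Z where
      "Z \<subseteq> X" "Z \<Turnstile> consts_of (map (val v) a) \<sqsubseteq> b" "v \<in> Z" by auto
    then show ?thesis using InclExt.hyps by (auto simp: sat_incl)
  qed
  then show ?case using InclExt.hyps by (simp add: sat_incl)
next
  case (InclRdt a b x \<Gamma>)
  then have X: "X \<Turnstile> a \<sqsubseteq> b" by blast
  have "\<exists>Z\<subseteq>X. Z \<Turnstile> consts_of x \<sqsubseteq> b \<and> (\<forall>v\<in>X. map (val v) a = x \<longrightarrow> v \<in> Z)"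
  proof (cases "\<exists>v\<in>X. map (val v) a = x")
    case True
    \<comment> \<open>As soon as the antecedent is realised, the witness is found in the whole team.\<close>
    then have "X \<Turnstile> consts_of x \<sqsubseteq> b"
      using X InclRdt.hyps by (auto simp: sat_incl simp del: sat.simps)
    then show ?thesis by blast
  next
    case False
    then show ?thesis using sat_empty by blast
  qed
  then show ?case using InclRdt.hyps(2) by (simp add: sat_Imp del: sat.simps)
qed (auto simp: sat_incl)

section \<open>Finiteness of derivations and cut over classical assumptions\<close>

lemma deriv_mono: "\<Gamma> \<turnstile> \<phi> \<Longrightarrow> \<Gamma> \<subseteq> \<Gamma>' \<Longrightarrow> \<Gamma>' \<turnstile> \<phi>"
  using deriv.Weaken[of \<Gamma> \<phi> \<Gamma>'] by (simp add: Un_absorb1)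

lemma finite_support_step:
  "\<lbrakk>\<exists>F\<subseteq>\<Gamma>. finite F \<and> F \<turnstile> \<phi>; \<And>F. F \<turnstile> \<phi> \<Longrightarrow> F \<turnstile> \<chi>\<rbrakk> \<Longrightarrow> \<exists>F\<subseteq>\<Gamma>. finite F \<and> F \<turnstile> \<chi>"
  by blast

lemma finite_support_step2:
  assumes "\<exists>F\<subseteq>\<Gamma>. finite F \<and> F \<turnstile> \<phi>" "\<exists>F\<subseteq>\<Gamma>. finite F \<and> F \<turnstile> \<psi>"
    and step: "\<And>F. F \<turnstile> \<phi> \<Longrightarrow> F \<turnstile> \<psi> \<Longrightarrow> F \<turnstile> \<chi>"
  shows "\<exists>F\<subseteq>\<Gamma>. finite F \<and> F \<turnstile> \<chi>"
proof -
  from assms(1,2) obtain F G where FG: "F \<subseteq> \<Gamma>" "finite F" "F \<turnstile> \<phi>" "G \<subseteq> \<Gamma>" "finite G" "G \<turnstile> \<psi>"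
    by blast
  have "F \<union> G \<turnstile> \<phi>" "F \<union> G \<turnstile> \<psi>"
    by (rule deriv_mono[OF FG(3)], blast, rule deriv_mono[OF FG(6)], blast)
  then have "F \<union> G \<turnstile> \<chi>" by (rule step)
  then show ?thesis using FG by (intro exI[of _ "F \<union> G"]) blast
qed

lemma deriv_finite: "\<Gamma> \<turnstile> \<phi> \<Longrightarrow> \<exists>F\<subseteq>\<Gamma>. finite F \<and> F \<turnstile> \<phi>"
proof (induction rule: deriv.induct)
  case (Assm \<phi> \<Gamma>)
  then show ?case by (intro exI[of _ "{\<phi>}"]) (auto intro: deriv.Assm)
next
  case (Weaken \<Gamma> \<phi> \<Gamma>') then show ?case by blast
next
  case (TopI \<Gamma>)
  show ?case by (intro exI[of _ "{}"]) (auto intro: deriv.TopI)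
next
  case (NegI \<Delta> \<alpha>)
  from NegI.IH obtain F where F: "F \<subseteq> emb ` \<Delta> \<union> {emb \<alpha>}" "finite F" "F \<turnstile> Atom Bot" by blast
  have fin: "finite (F - {emb \<alpha>})" using F(2) by simp
  have "F - {emb \<alpha>} \<subseteq> emb ` \<Delta>" using F(1) by blast
  from finite_subset_image[OF fin this]
  obtain D where D: "D \<subseteq> \<Delta>" "finite D" "F - {emb \<alpha>} = emb ` D" by blast
  have "emb ` D \<union> {emb \<alpha>} \<turnstile> Atom Bot" using F(3) by (rule deriv_mono) (use D(3) in blast)
  then have "emb ` D \<turnstile> Neg \<alpha>" by (rule deriv.NegI)
  moreover have "emb ` D \<subseteq> emb ` \<Delta>" "finite (emb ` D)" using D by auto
  ultimately show ?case by (intro exI[of _ "emb ` D"]) simp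
next
  case (RAA \<Delta> \<alpha>)
  from RAA.IH obtain F where F: "F \<subseteq> emb ` \<Delta> \<union> {Neg \<alpha>}" "finite F" "F \<turnstile> Atom Bot" by blast
  have fin: "finite (F - {Neg \<alpha>})" using F(2) by simp
  have "F - {Neg \<alpha>} \<subseteq> emb ` \<Delta>" using F(1) by blast
  from finite_subset_image[OF fin this]
  obtain D where D: "D \<subseteq> \<Delta>" "finite D" "F - {Neg \<alpha>} = emb ` D" by blast
  have "emb ` D \<union> {Neg \<alpha>} \<turnstile> Atom Bot" using F(3) by (rule deriv_mono) (use D(3) in blast)
  then have "emb ` D \<turnstile> emb \<alpha>" by (rule deriv.RAA)
  moreover have "emb ` D \<subseteq> emb ` \<Delta>" "finite (emb ` D)" using D by auto
  ultimately show ?case by (intro exI[of _ "emb ` D"]) simp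
next
  case (NegE \<Gamma> \<alpha> \<phi>)
  from NegE.IH show ?case by (rule finite_support_step2) (rule deriv.NegE)
next
  case (AndI \<Gamma> \<phi> \<psi>)
  from AndI.IH show ?case by (rule finite_support_step2) (rule deriv.AndI)
next
  case (OrE \<Gamma> \<phi> \<psi> \<Delta> \<chi>)
  then obtain F G H where FGH: "F \<subseteq> \<Gamma>" "finite F" "F \<turnstile> Or \<phi> \<psi>"
    "G \<subseteq> emb ` \<Delta> \<union> {\<phi>}" "finite G" "G \<turnstile> \<chi>" "H \<subseteq> emb ` \<Delta> \<union> {\<psi>}" "finite H" "H \<turnstile> \<chi>" by blast
  then have "finite (G - {\<phi>} \<union> (H - {\<psi>}))" "G - {\<phi>} \<union> (H - {\<psi>}) \<subseteq> emb ` \<Delta>" by auto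
  then obtain D where D: "D \<subseteq> \<Delta>" "finite D" "G - {\<phi>} \<union> (H - {\<psi>}) = emb ` D"
    by (meson finite_subset_image)
  have "F \<union> emb ` D \<turnstile> \<chi>"
  proof (rule deriv.OrE[OF FGH(3)])
    show "emb ` D \<union> {\<phi>} \<turnstile> \<chi>" using FGH(6) by (rule deriv_mono) (use D(3) in blast)
    show "emb ` D \<union> {\<psi>} \<turnstile> \<chi>" using FGH(9) by (rule deriv_mono) (use D(3) in blast)
  qed
  then show ?case using FGH D by (intro exI[of _ "F \<union> emb ` D"]) auto
next
  case (InclTrs a b c \<Gamma>)
  from InclTrs.IH show ?case by (rule finite_support_step2) (rule deriv.InclTrs[OF InclTrs.hyps(1,2)])
next
  case (InclId \<Gamma> a)
  show ?case by (intro exI[of _ "{}"]) (auto intro: deriv.InclId)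
next
  case (InclCmp a b \<alpha> \<Gamma>)
  from InclCmp.IH show ?case by (rule finite_support_step2) (rule deriv.InclCmp[OF InclCmp.hyps(1,2)])
next
  case (Incl0ExtPos a b \<Gamma> p)
  from Incl0ExtPos.IH show ?case by (rule finite_support_step2) (rule deriv.Incl0ExtPos[OF Incl0ExtPos.hyps(1)])
next
  case (Incl0ExtNeg a b \<Gamma> p)
  from Incl0ExtNeg.IH show ?case by (rule finite_support_step2) (rule deriv.Incl0ExtNeg[OF Incl0ExtNeg.hyps(1)])
next
  case (OrIncl0E x a \<Gamma> \<phi> \<psi> \<chi>)
  then obtain F G H K where F: "F \<subseteq> \<Gamma>" "finite F" "F \<turnstile> Or (And \<phi> (consts_of x \<sqsubseteq> a)) \<psi>"
    and G: "G \<subseteq> \<Gamma> \<union> {\<phi>, consts_of x \<sqsubseteq> a}" "finite G" "G \<turnstile> \<chi>"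
    and H: "H \<subseteq> \<Gamma> \<union> {\<psi>}" "finite H" "H \<turnstile> \<chi>"
    and K: "K \<subseteq> \<Gamma> \<union> {Or \<phi> \<psi>, consts_of x \<sqsubseteq> a}" "finite K" "K \<turnstile> \<chi>" by blast
  let ?F = "F \<union> (G \<inter> \<Gamma>) \<union> (H \<inter> \<Gamma>) \<union> (K \<inter> \<Gamma>)"
  have "?F \<turnstile> \<chi>"
  proof (rule deriv.OrIncl0E[OF OrIncl0E.hyps(1)])
    show "?F \<turnstile> Or (And \<phi> (consts_of x \<sqsubseteq> a)) \<psi>" using F(3) by (rule deriv_mono) blast
    show "?F \<union> {\<phi>, consts_of x \<sqsubseteq> a} \<turnstile> \<chi>" using G(3) by (rule deriv_mono) (use G(1) in blast)
    show "?F \<union> {\<psi>} \<turnstile> \<chi>" using H(3) by (rule deriv_mono) (use H(1) in blast)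
    show "?F \<union> {Or \<phi> \<psi>, consts_of x \<sqsubseteq> a} \<turnstile> \<chi>" using K(3) by (rule deriv_mono) (use K(1) in blast)
  qed
  then show ?case using F G H K by (intro exI[of _ ?F]) auto
next
  case (Incl0Dst xas \<Gamma> \<phi> \<psi>)
  then obtain F where F: "F \<subseteq> \<Gamma>" "finite F" "F \<turnstile> Or \<phi> \<psi>" by blast
  have "\<forall>xa\<in>set xas. \<exists>G\<subseteq>\<Gamma>. finite G \<and> G \<turnstile> consts_of (fst xa) \<sqsubseteq> snd xa"
    using Incl0Dst.IH(2) by auto
  then obtain g where g: "\<forall>xa\<in>set xas. g xa \<subseteq> \<Gamma> \<and> finite (g xa) \<and> g xa \<turnstile> consts_of (fst xa) \<sqsubseteq> snd xa"
    by metis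
  let ?F = "F \<union> \<Union>(g ` set xas)"
  have "?F \<turnstile> Or \<phi> \<psi>" using F(3) by (rule deriv_mono) blast
  moreover have "?F \<turnstile> consts_of x \<sqsubseteq> a" if "(x, a) \<in> set xas" for x a
  proof (rule deriv_mono)
    show "g (x, a) \<turnstile> consts_of x \<sqsubseteq> a" using g that by fastforce
  qed (use that in blast)
  ultimately have "?F \<turnstile> Or (foldl And (foldl Or \<phi> (map (\<lambda>(x, a). emb (seq_power a x)) xas))
      (map (\<lambda>(x, a). consts_of x \<sqsubseteq> a) xas)) \<psi>"
    using Incl0Dst.hyps(1) by (intro deriv.Incl0Dst) auto
  then show ?case using F g by (intro exI[of _ ?F]) auto
next
  case (AndE1 \<Gamma> \<phi> \<psi>)
  from AndE1.IH show ?case by (rule finite_support_step) (rule deriv.AndE1)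
next
  case (AndE2 \<Gamma> \<phi> \<psi>)
  from AndE2.IH show ?case by (rule finite_support_step) (rule deriv.AndE2)
next
  case (OrI1 \<Gamma> \<phi> \<psi>)
  from OrI1.IH show ?case by (rule finite_support_step) (rule deriv.OrI1)
next
  case (OrI2 \<Gamma> \<phi> \<psi>)
  from OrI2.IH show ?case by (rule finite_support_step) (rule deriv.OrI2)
next
  case (InclExc a a' b b' c c' \<Gamma>)
  from InclExc.IH show ?case by (rule finite_support_step) (rule deriv.InclExc[OF InclExc.hyps(1-3)])
next
  case (InclCtr a c b d \<Gamma>)
  from InclCtr.IH show ?case by (rule finite_support_step) (rule deriv.InclCtr[OF InclCtr.hyps(1,2)])
next
  case (InclWk a c b d \<Gamma>)
  from InclWk.IH show ?case by (rule finite_support_step) (rule deriv.InclWk[OF InclWk.hyps(1,2)])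
next
  case (Incl0ExtTop a b \<Gamma>)
  from Incl0ExtTop.IH show ?case by (rule finite_support_step) (rule deriv.Incl0ExtTop[OF Incl0ExtTop.hyps(1)])
next
  case (Incl0ExtBot a b \<Gamma>)
  from Incl0ExtBot.IH show ?case by (rule finite_support_step) (rule deriv.Incl0ExtBot[OF Incl0ExtBot.hyps(1)])
next
  case (InclExt a b \<Gamma>)
  from InclExt.IH show ?case by (rule finite_support_step) (rule deriv.InclExt[OF InclExt.hyps(1)])
next
  case (InclRdt a b x \<Gamma>)
  from InclRdt.IH show ?case by (rule finite_support_step) (rule deriv.InclRdt[OF InclRdt.hyps(1,2)])
qed

text \<open>
  Cut is first proved under this condition, which survives the passage to the classical
  contexts of \<open>\<not>I\<close>, RAA and \<open>\<or>E\<close>: there only the classical part of \<open>G\<close> may be kept, so that part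
  alone has to yield the classical members of \<open>\<Gamma>\<close>.
\<close>

definition supports :: "'p form set \<Rightarrow> 'p form set \<Rightarrow> bool" where
  "supports G \<Gamma> \<longleftrightarrow> (\<forall>\<gamma>\<in>\<Gamma>. G \<turnstile> \<gamma>) \<and> (\<forall>\<alpha>. emb \<alpha> \<in> \<Gamma> \<longrightarrow> emb ` {\<beta>. emb \<beta> \<in> G} \<turnstile> emb \<alpha>)"

lemma supports_Un:
  assumes "supports G \<Gamma>"
  shows "supports (G \<union> E) (\<Gamma> \<union> E)"
proof -
  have "emb ` {\<beta>. emb \<beta> \<in> G \<union> E} \<turnstile> emb \<alpha>" if "emb \<alpha> \<in> \<Gamma> \<union> E" for \<alpha>
  proof (cases "emb \<alpha> \<in> \<Gamma>")
    case True
    then have "emb ` {\<beta>. emb \<beta> \<in> G} \<turnstile> emb \<alpha>" using assms by (auto simp: supports_def)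
    then show ?thesis by (rule deriv_mono) auto
  qed (use that in \<open>auto intro: deriv.Assm\<close>)
  then show ?thesis using assms unfolding supports_def by (auto intro: deriv.Assm elim: deriv_mono)
qed

lemma supports_subset: "supports G \<Gamma> \<Longrightarrow> \<Delta> \<subseteq> \<Gamma> \<Longrightarrow> supports G \<Delta>"
  unfolding supports_def by blast

lemma supports_classical:
  assumes "supports G \<Gamma>" "emb ` \<Delta> \<subseteq> \<Gamma>"
  shows "supports (emb ` {\<beta>. emb \<beta> \<in> G}) (emb ` \<Delta>)"
proof -
  have "{\<beta>. emb \<beta> \<in> emb ` {\<beta>. emb \<beta> \<in> G}} = {\<beta>. emb \<beta> \<in> G}"
    by auto
  then show ?thesis using assms unfolding supports_def by auto
qed

lemma cut_classical_part: "\<Gamma> \<turnstile> \<chi> \<Longrightarrow> supports G \<Gamma> \<Longrightarrow> G \<turnstile> \<chi>"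
proof (induction arbitrary: G rule: deriv.induct)
  case (Assm \<phi> \<Gamma>) then show ?case by (auto simp: supports_def)
next
  case (Weaken \<Gamma> \<phi> \<Gamma>') then show ?case by (auto intro: supports_subset)
next
  case (NegI \<Delta> \<alpha>)
  let ?D = "{\<beta>. emb \<beta> \<in> G}"
  have "emb ` ?D \<union> {emb \<alpha>} \<turnstile> Atom Bot"
    by (intro NegI.IH supports_Un supports_classical[OF NegI.prems]) blast
  then have "emb ` ?D \<turnstile> Neg \<alpha>" by (rule deriv.NegI)
  then show ?case by (rule deriv_mono) auto
next
  case (RAA \<Delta> \<alpha>)
  let ?D = "{\<beta>. emb \<beta> \<in> G}"
  have "emb ` ?D \<union> {Neg \<alpha>} \<turnstile> Atom Bot"
    by (intro RAA.IH supports_Un supports_classical[OF RAA.prems]) blast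
  then have "emb ` ?D \<turnstile> emb \<alpha>" by (rule deriv.RAA)
  then show ?case by (rule deriv_mono) auto
next
  case (OrE \<Gamma> \<phi> \<psi> \<Delta> \<chi>)
  let ?D = "{\<beta>. emb \<beta> \<in> G}"
  have main: "G \<turnstile> Or \<phi> \<psi>" by (intro OrE.IH(1) supports_subset[OF OrE.prems]) blast
  have D: "supports (emb ` ?D) (emb ` \<Delta>)"
    by (rule supports_classical[OF OrE.prems]) blast
  have "G \<union> emb ` ?D \<turnstile> \<chi>"
    by (rule deriv.OrE[OF main OrE.IH(2,3)[OF supports_Un[OF D]]])
  then show ?case by (rule deriv_mono) auto
next
  case (OrIncl0E x a \<Gamma> \<phi> \<psi> \<chi>)
  show ?case
    by (rule deriv.OrIncl0E[OF OrIncl0E.hyps(1) OrIncl0E.IH(1)[OF OrIncl0E.prems]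
          OrIncl0E.IH(2-4)[OF supports_Un[OF OrIncl0E.prems]]])
next
  case (Incl0Dst xas \<Gamma> \<phi> \<psi>)
  show ?case
    by (rule deriv.Incl0Dst[OF Incl0Dst.hyps(1) Incl0Dst.IH(1)[OF Incl0Dst.prems] Incl0Dst.IH(2)[OF _ Incl0Dst.prems]])
next
  case (TopI \<Gamma>) show ?case by (rule deriv.TopI)
next
  case (NegE \<Gamma> \<alpha> \<phi>)
  show ?case by (rule deriv.NegE[OF NegE.IH[OF NegE.prems]])
next
  case (AndI \<Gamma> \<phi> \<psi>)
  show ?case by (rule deriv.AndI[OF AndI.IH[OF AndI.prems]])
next
  case (AndE1 \<Gamma> \<phi> \<psi>)
  show ?case by (rule deriv.AndE1[OF AndE1.IH[OF AndE1.prems]])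
next
  case (AndE2 \<Gamma> \<phi> \<psi>)
  show ?case by (rule deriv.AndE2[OF AndE2.IH[OF AndE2.prems]])
next
  case (OrI1 \<Gamma> \<phi> \<psi>)
  show ?case by (rule deriv.OrI1[OF OrI1.IH[OF OrI1.prems]])
next
  case (OrI2 \<Gamma> \<phi> \<psi>)
  show ?case by (rule deriv.OrI2[OF OrI2.IH[OF OrI2.prems]])
next
  case (InclExc a a' b b' c c' \<Gamma>)
  show ?case by (rule deriv.InclExc[OF InclExc.hyps(1-3) InclExc.IH[OF InclExc.prems]])
next
  case (InclCtr a c b d \<Gamma>)
  show ?case by (rule deriv.InclCtr[OF InclCtr.hyps(1,2) InclCtr.IH[OF InclCtr.prems]])
next
  case (InclWk a c b d \<Gamma>)
  show ?case by (rule deriv.InclWk[OF InclWk.hyps(1,2) InclWk.IH[OF InclWk.prems]])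
next
  case (InclTrs a b c \<Gamma>)
  show ?case by (rule deriv.InclTrs[OF InclTrs.hyps(1,2) InclTrs.IH[OF InclTrs.prems]])
next
  case (InclId \<Gamma> a) show ?case by (rule deriv.InclId)
next
  case (InclCmp a b \<alpha> \<Gamma>)
  show ?case by (rule deriv.InclCmp[OF InclCmp.hyps(1,2) InclCmp.IH[OF InclCmp.prems]])
next
  case (Incl0ExtTop a b \<Gamma>)
  show ?case by (rule deriv.Incl0ExtTop[OF Incl0ExtTop.hyps(1) Incl0ExtTop.IH[OF Incl0ExtTop.prems]])
next
  case (Incl0ExtBot a b \<Gamma>)
  show ?case by (rule deriv.Incl0ExtBot[OF Incl0ExtBot.hyps(1) Incl0ExtBot.IH[OF Incl0ExtBot.prems]])
next
  case (Incl0ExtPos a b \<Gamma> p)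
  show ?case by (rule deriv.Incl0ExtPos[OF Incl0ExtPos.hyps(1) Incl0ExtPos.IH[OF Incl0ExtPos.prems]])
next
  case (Incl0ExtNeg a b \<Gamma> p)
  show ?case by (rule deriv.Incl0ExtNeg[OF Incl0ExtNeg.hyps(1) Incl0ExtNeg.IH[OF Incl0ExtNeg.prems]])
next
  case (InclExt a b \<Gamma>)
  show ?case by (rule deriv.InclExt[OF InclExt.hyps(1) InclExt.IH[OF InclExt.prems]])
next
  case (InclRdt a b x \<Gamma>)
  show ?case by (rule deriv.InclRdt[OF InclRdt.hyps(1,2) InclRdt.IH[OF InclRdt.prems]])
qed

lemma cut_classical:
  assumes "\<Gamma> \<turnstile> \<chi>" "\<And>\<gamma>. \<gamma> \<in> \<Gamma> \<Longrightarrow> emb ` \<Delta> \<turnstile> \<gamma>"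
  shows "emb ` \<Delta> \<turnstile> \<chi>"
proof (rule cut_classical_part[OF assms(1)])
  have "emb ` {\<beta>. emb \<beta> \<in> emb ` \<Delta>} = emb ` \<Delta>" by auto
  then show "supports (emb ` \<Delta>) \<Gamma>" using assms(2) by (simp add: supports_def)
qed

text \<open>
  A single assumption can always be cut: \<open>\<or>E\<close> applies to \<open>\<phi> \<or> \<phi>\<close> with an empty side context.
\<close>

lemma cut_single: "\<Gamma> \<turnstile> \<phi> \<Longrightarrow> {\<phi>} \<turnstile> \<chi> \<Longrightarrow> \<Gamma> \<turnstile> \<chi>"
  using deriv.OrE[of \<Gamma> \<phi> \<phi> "{}" \<chi>] by (simp add: deriv.OrI1)

section \<open>Classical completeness\<close>

text \<open>
  Used twice: for consistent sets of classical formulas, and for sets of arbitrary formulas that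
  do not derive a given formula. Finiteness of derivations makes both properties finitary.
\<close>

lemma maximal_extension:
  assumes "P A" and finitary: "\<And>B. P B \<longleftrightarrow> (\<forall>F\<subseteq>B. finite F \<longrightarrow> P F)"
  shows "\<exists>M. A \<subseteq> M \<and> P M \<and> (\<forall>B. M \<subseteq> B \<longrightarrow> P B \<longrightarrow> B = M)"
proof -
  let ?S = "{B. A \<subseteq> B \<and> P B}"
  have "\<exists>M\<in>?S. \<forall>B\<in>?S. M \<subseteq> B \<longrightarrow> B = M"
  proof (rule subset_Zorn_nonempty)
    show "?S \<noteq> {}" using assms(1) by blast
  next
    fix C assume C: "C \<noteq> {}" "subset.chain ?S C"
    have "P F" if F: "F \<subseteq> \<Union>C" "finite F" for F
    proof -
      obtain B where "B \<in> C" "F \<subseteq> B"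
        using finite_subset_Union_chain[OF F(2,1) C] by blast
      then have "P B" using C(2) by (auto simp: subset_chain_def)
      with \<open>F \<subseteq> B\<close> F(2) show ?thesis using finitary[of B] by blast
    qed
    then have "P (\<Union>C)" using finitary[of "\<Union>C"] by blast
    moreover obtain B where "B \<in> C" using C(1) by blast
    then have "A \<subseteq> \<Union>C" using C(2) unfolding subset_chain_def by blast
    ultimately show "\<Union>C \<in> ?S" by blast
  qed
  then obtain M where M: "A \<subseteq> M" "P M" and max: "\<forall>B\<in>?S. M \<subseteq> B \<longrightarrow> B = M" by blast
  show ?thesis
  proof (intro exI[of _ M] conjI allI impI)
    fix B assume "M \<subseteq> B" "P B"
    then show "B = M" using M(1) max by blast
  qed (use M in simp_all)
qed

lemma explosion: "\<Gamma> \<turnstile> Atom Bot \<Longrightarrow> \<Gamma> \<turnstile> \<phi>"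
proof -
  have "emb ` {} \<union> {emb (CAtom Bot)} \<turnstile> Atom Bot" by (auto intro: deriv.Assm)
  then have "emb ` {} \<turnstile> Neg (CAtom Bot)" by (rule deriv.NegI)
  then have "\<Gamma> \<turnstile> Neg (CAtom Bot)" by (rule deriv_mono) auto
  then show "\<Gamma> \<turnstile> Atom Bot \<Longrightarrow> \<Gamma> \<turnstile> \<phi>" using deriv.NegE[of \<Gamma> "CAtom Bot" \<phi>] by simp
qed

text \<open>
  The usual Henkin argument, available because all contexts in it are classical.
\<close>

lemma classical_model:
  assumes "\<not> emb ` \<Delta> \<turnstile> Atom Bot"
  obtains v where "\<forall>\<alpha>\<in>\<Delta>. ceval (val v) \<alpha>"
proof -
  let ?P = "\<lambda>D. \<not> emb ` D \<turnstile> Atom Bot"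
  have "?P B \<longleftrightarrow> (\<forall>F\<subseteq>B. finite F \<longrightarrow> ?P F)" for B
  proof -
    have "\<exists>F\<subseteq>B. finite F \<and> emb ` F \<turnstile> Atom Bot" if B: "emb ` B \<turnstile> Atom Bot"
    proof -
      obtain F where F: "F \<subseteq> emb ` B" "finite F" "F \<turnstile> Atom Bot" using deriv_finite[OF B] by blast
      from finite_subset_image[OF F(2,1)] obtain D where "D \<subseteq> B" "finite D" "F = emb ` D" by blast
      then show ?thesis using F(3) by (intro exI[of _ D]) simp
    qed
    moreover have "emb ` B \<turnstile> Atom Bot" if "F \<subseteq> B" "emb ` F \<turnstile> Atom Bot" for F
      using that(2) by (rule deriv_mono) (rule image_mono[OF that(1)])
    ultimately show ?thesis by metis
  qed
  from maximal_extension[of ?P, OF assms this]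
  obtain M where M: "\<Delta> \<subseteq> M" "?P M" and max: "\<forall>B. M \<subseteq> B \<longrightarrow> ?P B \<longrightarrow> B = M"
    by (elim exE conjE)
  have closed: "\<alpha> \<in> M" if "emb ` M \<turnstile> emb \<alpha>" for \<alpha>
  proof -
    have "\<not> emb ` M \<union> {emb \<alpha>} \<turnstile> Atom Bot"
    proof
      assume "emb ` M \<union> {emb \<alpha>} \<turnstile> Atom Bot"
      then have "emb ` M \<turnstile> Atom Bot"
      proof (rule cut_classical)
        show "emb ` M \<turnstile> \<gamma>" if "\<gamma> \<in> emb ` M \<union> {emb \<alpha>}" for \<gamma>
          using that \<open>emb ` M \<turnstile> emb \<alpha>\<close> deriv.Assm by blast
      qed
      with M(2) show False ..
    qed
    then show ?thesis using max[rule_format, of "insert \<alpha> M"] by auto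
  qed
  have neg: "CNeg \<alpha> \<in> M \<longleftrightarrow> \<alpha> \<notin> M" for \<alpha>
  proof
    assume "CNeg \<alpha> \<in> M"
    show "\<alpha> \<notin> M"
    proof
      assume "\<alpha> \<in> M"
      have "emb ` M \<turnstile> Neg \<alpha>" "emb ` M \<turnstile> emb \<alpha>"
        using \<open>CNeg \<alpha> \<in> M\<close> \<open>\<alpha> \<in> M\<close> by (force intro: deriv.Assm)+
      then have "emb ` M \<turnstile> Atom Bot" by (rule deriv.NegE[rotated])
      with M(2) show False ..
    qed
  next
    assume "\<alpha> \<notin> M"
    then have "\<not> ?P (insert \<alpha> M)" using max[rule_format, of "insert \<alpha> M"] by auto
    then have "emb ` M \<turnstile> Neg \<alpha>" by (intro deriv.NegI) simp
    then show "CNeg \<alpha> \<in> M" using closed[of "CNeg \<alpha>"] by simp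
  qed
  have mem: "emb ` M \<turnstile> emb \<alpha> \<longleftrightarrow> \<alpha> \<in> M" for \<alpha>
    using closed by (auto intro: deriv.Assm)
  let ?v = "\<lambda>p. CAtom (PVar p) \<in> M"
  have "ceval (val ?v) \<alpha> \<longleftrightarrow> \<alpha> \<in> M" for \<alpha>
  proof (induction \<alpha>)
    case (CAtom a)
    then show ?case
      using M(2) mem[of "CAtom Bot"] mem[of "CAtom Top"] deriv.TopI[of "emb ` M"] by (cases a) auto
  next
    case (CNeg \<alpha>) then show ?case using neg by simp
  next
    case (CAnd \<alpha> \<beta>)
    have "CAnd \<alpha> \<beta> \<in> M \<longleftrightarrow> \<alpha> \<in> M \<and> \<beta> \<in> M"
      unfolding mem[symmetric] emb.simps using deriv.AndI deriv.AndE1 deriv.AndE2 by metis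
    then show ?case using CAnd by simp
  next
    case (COr \<alpha> \<beta>)
    have "\<alpha> \<in> M \<or> \<beta> \<in> M" if "COr \<alpha> \<beta> \<in> M"
    proof (rule ccontr)
      assume n: "\<not> (\<alpha> \<in> M \<or> \<beta> \<in> M)"
      have or: "emb ` M \<turnstile> Or (emb \<alpha>) (emb \<beta>)" using that mem[of "COr \<alpha> \<beta>"] by simp
      have "emb ` M \<union> {emb \<theta>} \<turnstile> Atom Bot" if "\<theta> \<notin> M" for \<theta>
        using max[rule_format, of "insert \<theta> M"] that by auto
      then have "emb ` M \<union> emb ` M \<turnstile> Atom Bot" using n by (intro deriv.OrE[OF or]) auto
      then show False using M(2) by simp
    qed
    moreover have "COr \<alpha> \<beta> \<in> M" if "\<alpha> \<in> M \<or> \<beta> \<in> M"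
      using that unfolding mem[symmetric] emb.simps using deriv.OrI1 deriv.OrI2 by metis
    ultimately show ?case using COr by auto
  qed
  then show thesis using M(1) that[of ?v] by blast
qed

lemma classical_completeness:
  assumes "\<And>v. \<forall>\<delta>\<in>\<Delta>. ceval (val v) \<delta> \<Longrightarrow> ceval (val v) \<alpha>"
  shows "emb ` \<Delta> \<turnstile> emb \<alpha>"
proof (rule deriv.RAA, rule ccontr)
  assume "\<not> emb ` \<Delta> \<union> {Neg \<alpha>} \<turnstile> Atom Bot"
  then obtain v where "\<forall>\<beta>\<in>insert (CNeg \<alpha>) \<Delta>. ceval (val v) \<beta>"
    using classical_model[of "insert (CNeg \<alpha>) \<Delta>"] by auto
  then show False using assms by auto
qed

section \<open>Inclusion atoms\<close>

lemma deriv_swap_blocks: "\<Gamma> \<turnstile> Incl (a @ b @ c) \<Longrightarrow> \<Gamma> \<turnstile> Incl (b @ a @ c)"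
  using deriv.InclExc[of "map fst a" "map snd a" "map fst b" "map snd b" "map fst c" "map snd c" \<Gamma>]
  by (simp add: zip_append zip_map_fst_snd)

text \<open>
  The structural rules \<open>\<subseteq>Exc\<close>, \<open>\<subseteq>Wk\<close> and \<open>\<subseteq>Ctr\<close> together say that an inclusion atom depends only on the
  set of its pairs: the wanted pairs are copied to the front one at a time, then the old ones are dropped.
\<close>

lemma deriv_incl_subset:
  assumes "\<Gamma> \<turnstile> Incl qs" "set rs \<subseteq> set qs"
  shows "\<Gamma> \<turnstile> Incl rs"
proof -
  have "\<Gamma> \<turnstile> Incl (rs @ qs)"
    using assms(2)
  proof (induction rs)
    case Nil then show ?case using assms(1) by simp
  next
    case (Cons r rs)
    then obtain q1 q2 where q: "qs = q1 @ r # q2" by (metis list.set_intros(1) split_list subsetD)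
    have "\<Gamma> \<turnstile> Incl ((rs @ q1) @ [r] @ q2)" using Cons q by simp
    then have "\<Gamma> \<turnstile> Incl ([r] @ (rs @ q1) @ q2)" by (rule deriv_swap_blocks)
    then have "\<Gamma> \<turnstile> Incl ([r] @ [r] @ (rs @ q1) @ q2)"
      using deriv.InclWk[of "[fst r]" "[snd r]" "map fst (rs @ q1 @ q2)" "map snd (rs @ q1 @ q2)" \<Gamma>]
      by (simp add: zip_append zip_map_fst_snd)
    then have "\<Gamma> \<turnstile> Incl ([r] @ ([r] @ rs @ q1) @ q2)" by simp
    then have "\<Gamma> \<turnstile> Incl (([r] @ rs @ q1) @ [r] @ q2)" by (rule deriv_swap_blocks)
    then show ?case using q by simp
  qed
  then show ?thesis
    using deriv.InclCtr[of "map fst rs" "map snd rs" "map fst qs" "map snd qs" \<Gamma>]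
    by (simp add: zip_append zip_map_fst_snd)
qed

lemma deriv_incl_consts: "\<Gamma> \<turnstile> Incl qs \<Longrightarrow> \<Gamma> \<turnstile> Incl ((Top, Top) # (Bot, Bot) # qs)"
  using deriv.Incl0ExtTop[of "Bot # map fst qs" "Bot # map snd qs" \<Gamma>]
    deriv.Incl0ExtBot[of "map fst qs" "map snd qs" \<Gamma>]
  by (simp add: zip_map_fst_snd)

text \<open>
  \<open>\<subseteq>Cmp\<close> without placeholders: the schematic formula has the pairs of the inclusion atom
  themselves as its atoms.
\<close>

lemma deriv_incl_transfer:
  assumes "\<Gamma> \<turnstile> Incl qs" "catoms \<gamma> \<subseteq> set qs" "\<Gamma> \<turnstile> emb (map_cform snd \<gamma>)"
  shows "\<Gamma> \<turnstile> emb (map_cform fst \<gamma>)"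
proof -
  from assms(2) have "\<forall>q\<in>catoms \<gamma>. \<exists>i. i < length qs \<and> qs ! i = q"
    by (metis in_set_conv_nth subsetD)
  then obtain idx where idx: "\<forall>q\<in>catoms \<gamma>. idx q < length qs \<and> qs ! idx q = q" by metis
  \<comment> \<open>The placeholder for a pair is some position at which the pair occurs.\<close>
  have eq: "map_cform (\<lambda>i. map f qs ! i) (map_cform idx \<gamma>) = map_cform f \<gamma>" for f :: "_ \<Rightarrow> 'a atom"
    unfolding cform.map_comp using idx by (intro cform.map_cong) auto
  have "\<Gamma> \<turnstile> emb (map_cform (\<lambda>i. map fst qs ! i) (map_cform idx \<gamma>))"
  proof (rule deriv.InclCmp[of "map fst qs" "map snd qs"])
    show "catoms (map_cform idx \<gamma>) \<subseteq> {..<length (map snd qs)}"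
      using idx by (auto simp: cform.set_map)
  qed (use assms eq in \<open>simp_all add: zip_map_fst_snd\<close>)
  then show ?thesis by (simp only: eq)
qed

text \<open>
  In a nonempty team, \<open>row ps x\<close> says that some valuation takes the values \<open>x\<close> on \<open>ps\<close>, and the
  classical formula \<open>row_power ps x\<close> says that all of them do.
\<close>

abbreviation row :: "'p list \<Rightarrow> bool list \<Rightarrow> 'p form" where
  "row ps x \<equiv> consts_of x \<sqsubseteq> map PVar ps"

abbreviation row_power :: "'p list \<Rightarrow> bool list \<Rightarrow> 'p classical" where
  "row_power ps x \<equiv> seq_power (map PVar ps) x"

lemma ceval_row_power [simp]:
  "length x = length ps \<Longrightarrow> ceval (val v) (row_power ps x) \<longleftrightarrow> map v ps = x"
  using ceval_seq_power[of "map PVar ps" x v] by (simp add: comp_def)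

lemma zip_row: "zip (consts_of (map u ps)) (map PVar ps)
    = map (\<lambda>p. (if u p then Top else Bot, PVar p)) ps"
  unfolding consts_of_def by (induction ps) auto

lemma val_const [simp]: "val v (if b then Top else Bot) = b"
  by simp

text \<open>
  If the values of \<open>u\<close> on \<open>ps\<close> occur in the team, then \<open>\<subseteq>Cmp\<close> replaces every variable in \<open>\<alpha>\<close> by its
  value under \<open>u\<close>. The result has no variables and is false, hence classically inconsistent.
  Every refutation of a formula by a member of the team goes through this lemma.
\<close>

lemma deriv_row_refute:
  assumes row: "\<Gamma> \<turnstile> row ps (map u ps)" and \<alpha>: "\<Gamma> \<turnstile> emb \<alpha>"
    and atoms: "catoms \<alpha> \<subseteq> PVar ` set ps \<union> {Top, Bot}" and false: "\<not> ceval (val u) \<alpha>"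
  shows "\<Gamma> \<turnstile> \<chi>"
proof -
  let ?q = "\<lambda>a. (if val u a then Top else Bot, a)"
  let ?qs = "(Top, Top) # (Bot, Bot) # zip (consts_of (map u ps)) (map PVar ps)"
  have 1: "map_cform snd (map_cform ?q \<alpha>) = \<alpha>"
    by (simp add: cform.map_comp comp_def cform.map_ident)
  have "\<Gamma> \<turnstile> emb (map_cform fst (map_cform ?q \<alpha>))"
  proof (rule deriv_incl_transfer)
    show "\<Gamma> \<turnstile> Incl ?qs" using row by (rule deriv_incl_consts)
    show "catoms (map_cform ?q \<alpha>) \<subseteq> set ?qs"
      using atoms unfolding zip_row by (auto simp: cform.set_map)
    show "\<Gamma> \<turnstile> emb (map_cform snd (map_cform ?q \<alpha>))" unfolding 1 by (rule \<alpha>)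
  qed
  moreover have "\<not> ceval (val v) (map_cform fst (map_cform ?q \<alpha>))" for v
    using false by (simp add: ceval_map_cform del: val.simps)
  then have "emb ` {map_cform fst (map_cform ?q \<alpha>)} \<turnstile> emb (CAtom Bot)"
    by (intro classical_completeness) blast
  then have "{emb (map_cform fst (map_cform ?q \<alpha>))} \<turnstile> Atom Bot" by simp
  then have "{emb (map_cform fst (map_cform ?q \<alpha>))} \<turnstile> \<chi>" by (rule explosion)
  ultimately show ?thesis by (rule cut_single)
qed

text \<open>
  Where all valuations agree with \<open>x\<close> on \<open>ps\<close>, the inclusion atom \<open>x \<subseteq> ps\<close> is built up by
  \<open>\<subseteq>\<^sub>0Ext\<close> from the empty one.
\<close>

lemma deriv_row:
  assumes "length x = length ps"
    and "\<And>v. \<forall>\<delta>\<in>\<Delta>. ceval (val v) \<delta> \<Longrightarrow> map v ps = x"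
  shows "emb ` \<Delta> \<turnstile> row ps x"
  using assms
proof (induction x ps rule: list_induct2)
  case Nil
  then show ?case using deriv.InclId[of "emb ` \<Delta>" "[]"] by (simp add: consts_of_def)
next
  case (Cons b x p ps)
  have IH: "emb ` \<Delta> \<turnstile> row ps x" using Cons.prems by (intro Cons.IH) auto
  have l: "length (consts_of x) = length (map PVar ps)" using Cons.hyps by simp
  show ?case
  proof (cases b)
    case True
    have "emb ` \<Delta> \<turnstile> emb (CAtom (PVar p))"
      by (rule classical_completeness) (use Cons.prems True in auto)
    then have "emb ` \<Delta> \<turnstile> Top # consts_of x \<sqsubseteq> PVar p # map PVar ps"
      using IH by (intro deriv.Incl0ExtPos[OF l]) simp_all
    then show ?thesis using True by (simp add: consts_of_def)
  next
    case False
    have "emb ` \<Delta> \<turnstile> emb (CNeg (CAtom (PVar p)))"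
      by (rule classical_completeness) (use Cons.prems False in auto)
    then have "emb ` \<Delta> \<turnstile> Bot # consts_of x \<sqsubseteq> PVar p # map PVar ps"
      using IH by (intro deriv.Incl0ExtNeg[OF l]) simp_all
    then show ?thesis using False by (simp add: consts_of_def)
  qed
qed

section \<open>Case distinction on the rows of a team\<close>

lemma or_mono: "\<lbrakk>\<Gamma> \<turnstile> Or \<phi> \<psi>; {\<phi>} \<turnstile> \<phi>'; {\<psi>} \<turnstile> \<psi>'\<rbrakk> \<Longrightarrow> \<Gamma> \<turnstile> Or \<phi>' \<psi>'"
  using deriv.OrE[of \<Gamma> \<phi> \<psi> "{}" "Or \<phi>' \<psi>'"] by (simp add: deriv.OrI1 deriv.OrI2)

text \<open>
  By excluded middle and \<open>deriv_row\<close>, \<open>(ps\<^sup>x \<and> x \<subseteq> ps) \<or> \<not> ps\<^sup>x\<close> is derivable. Eliminating it with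
  \<open>\<or>\<^sub>\<subseteq>\<^sub>0E\<close> leaves only branches whose context contains \<open>x \<subseteq> ps\<close> or \<open>\<not> ps\<^sup>x\<close>; unlike \<open>\<or>E\<close>, this rule puts
  no restriction on the context.
\<close>

lemma row_split:
  assumes len: "length x = length ps"
    and pos: "\<Gamma> \<union> {row ps x} \<turnstile> \<chi>" and neg: "\<Gamma> \<union> {Neg (row_power ps x)} \<turnstile> \<chi>"
  shows "\<Gamma> \<turnstile> \<chi>"
proof (rule deriv.OrIncl0E)
  let ?\<pi> = "row_power ps x"
  show "length x = length (map PVar ps)" using len by simp
  have "emb ` {} \<turnstile> emb (COr ?\<pi> (CNeg ?\<pi>))" by (rule classical_completeness) simp
  from deriv_mono[OF this, of \<Gamma>] have em: "\<Gamma> \<turnstile> Or (emb ?\<pi>) (Neg ?\<pi>)" by simp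
  have "emb ` {?\<pi>} \<turnstile> row ps x" using len by (intro deriv_row) auto
  then have "{emb ?\<pi>} \<turnstile> And (emb ?\<pi>) (row ps x)"
    by (simp add: deriv.AndI deriv.Assm del: ceval_row_power)
  with em show "\<Gamma> \<turnstile> Or (And (emb ?\<pi>) (row ps x)) (Neg ?\<pi>)"
    by (rule or_mono) (simp add: deriv.Assm)
  show "\<Gamma> \<union> {emb ?\<pi>, row ps x} \<turnstile> \<chi>" using pos by (rule deriv_mono) auto
  show "\<Gamma> \<union> {Or (emb ?\<pi>) (Neg ?\<pi>), row ps x} \<turnstile> \<chi>" using pos by (rule deriv_mono) auto
qed (rule neg)

text \<open>
  The rows in \<open>R\<close> are asserted to occur, those in \<open>R'\<close> not to occur.
\<close>

definition diagram :: "'p list \<Rightarrow> bool list set \<Rightarrow> bool list set \<Rightarrow> 'p form set" where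
  "diagram ps R R' = row ps ` R \<union> (\<lambda>x. Neg (row_power ps x)) ` R'"

lemma rows_split:
  assumes "\<And>x. x \<in> set L \<Longrightarrow> length x = length ps"
    and "\<And>R. R \<subseteq> set L \<Longrightarrow> \<Gamma> \<union> diagram ps R (set L - R) \<turnstile> \<chi>"
  shows "\<Gamma> \<turnstile> \<chi>"
  using assms
proof (induction L arbitrary: \<Gamma>)
  case Nil
  then show ?case by (simp add: diagram_def)
next
  case (Cons x L)
  show ?case
  proof (rule row_split)
    show "length x = length ps" using Cons.prems(1) by simp
    show "\<Gamma> \<union> {row ps x} \<turnstile> \<chi>"
    proof (rule Cons.IH)
      fix R assume "R \<subseteq> set L"
      then have "\<Gamma> \<union> diagram ps (insert x R) (set (x # L) - insert x R) \<turnstile> \<chi>"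
        by (intro Cons.prems(2)) auto
      then show "\<Gamma> \<union> {row ps x} \<union> diagram ps R (set L - R) \<turnstile> \<chi>"
        by (rule deriv_mono) (auto simp: diagram_def)
    qed (simp add: Cons.prems(1))
    show "\<Gamma> \<union> {Neg (row_power ps x)} \<turnstile> \<chi>"
    proof (rule Cons.IH)
      fix R assume "R \<subseteq> set L"
      then have "\<Gamma> \<union> diagram ps R (set (x # L) - R) \<turnstile> \<chi>"
        by (intro Cons.prems(2)) auto
      then show "\<Gamma> \<union> {Neg (row_power ps x)} \<union> diagram ps R (set L - R) \<turnstile> \<chi>"
        by (rule deriv_mono) (auto simp: diagram_def)
    qed (simp add: Cons.prems(1))
  qed
qed

lemma team_split:
  assumes "\<And>R. R \<subseteq> {x. length x = length ps} \<Longrightarrow>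
    \<Gamma> \<union> diagram ps R ({x. length x = length ps} - R) \<turnstile> \<chi>"
  shows "\<Gamma> \<turnstile> \<chi>"
  by (rule rows_split[where L = "List.n_lists (length ps) [True, False]" and ps = ps])
    (use assms in \<open>simp_all add: set_n_lists_bool\<close>)

section \<open>Cut\<close>

lemma finite_catoms: "finite (catoms \<alpha>)"
  by (induction \<alpha>) auto

lemma finite_set_atom: "finite (set_atom a)"
  by (cases a) auto

lemma finite_vars: "finite (vars \<phi>)"
  by (induction \<phi>) (auto simp: finite_set_atom finite_catoms)

lemma vars_emb: "vars (emb \<alpha>) = \<Union>(set_atom ` catoms \<alpha>)"
  by (induction \<alpha>) auto

lemma catoms_subset:
  assumes "vars (emb \<alpha>) \<subseteq> V"
  shows "catoms \<alpha> \<subseteq> PVar ` V \<union> {Top, Bot}"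
proof
  fix a assume "a \<in> catoms \<alpha>"
  then have "set_atom a \<subseteq> V" using assms by (auto simp: vars_emb)
  then show "a \<in> PVar ` V \<union> {Top, Bot}" by (cases a) auto
qed

text \<open>
  Distinguish cases on the team over the variables of \<open>\<Gamma>\<close>. If one of its rows falsifies a classical
  member of \<open>\<Gamma>\<close>, the extended context is inconsistent. Otherwise the classical
  formulas \<open>\<not> ps\<^sup>x\<close>, for the missing rows \<open>x\<close>, already imply all classical members of \<open>\<Gamma>\<close>, so
  \<open>cut_classical_part\<close> applies.
\<close>

lemma finite_cut:
  assumes fin: "finite \<Gamma>" and \<chi>: "\<Gamma> \<turnstile> \<chi>" and G: "\<And>\<gamma>. \<gamma> \<in> \<Gamma> \<Longrightarrow> G \<turnstile> \<gamma>"
  shows "G \<turnstile> \<chi>"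
proof -
  have "finite (\<Union>(vars ` \<Gamma>))" using fin by (simp add: finite_vars)
  from finite_list[OF this] obtain ps where ps: "set ps = \<Union>(vars ` \<Gamma>)" ..
  show ?thesis
  proof (rule team_split)
    fix R :: "bool list set" assume R: "R \<subseteq> {x. length x = length ps}"
    let ?G = "G \<union> diagram ps R ({x. length x = length ps} - R)"
    have G': "?G \<turnstile> \<gamma>" if "\<gamma> \<in> \<Gamma>" for \<gamma>
      using G[OF that] by (rule deriv_mono) blast
    show "?G \<turnstile> \<chi>"
    proof (cases "\<exists>v \<alpha>. map v ps \<in> R \<and> emb \<alpha> \<in> \<Gamma> \<and> \<not> ceval (val v) \<alpha>")
      case True
      then obtain v \<alpha> where v: "map v ps \<in> R" "emb \<alpha> \<in> \<Gamma>" "\<not> ceval (val v) \<alpha>" by blast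
      show ?thesis
      proof (rule deriv_row_refute[where ps = ps and u = v and \<alpha> = \<alpha>])
        show "?G \<turnstile> row ps (map v ps)" using v(1) by (intro deriv.Assm) (simp add: diagram_def)
        show "catoms \<alpha> \<subseteq> PVar ` set ps \<union> {Top, Bot}" using v(2) ps by (intro catoms_subset) blast
      qed (use v G' in auto)
    next
      case False
      have "emb ` {\<beta>. emb \<beta> \<in> ?G} \<turnstile> emb \<alpha>" if "emb \<alpha> \<in> \<Gamma>" for \<alpha>
      proof (rule classical_completeness)
        fix v assume v: "\<forall>\<delta>\<in>{\<beta>. emb \<beta> \<in> ?G}. ceval (val v) \<delta>"
        have "map v ps \<in> R"
        proof (rule ccontr)
          assume "map v ps \<notin> R"
          then have "emb (CNeg (row_power ps (map v ps))) \<in> ?G" by (simp add: diagram_def)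
          then have "ceval (val v) (CNeg (row_power ps (map v ps)))" using v by blast
          then show False by simp
        qed
        then show "ceval (val v) \<alpha>" using False that by blast
      qed
      then have "supports ?G \<Gamma>" using G' by (simp add: supports_def)
      then show ?thesis by (rule cut_classical_part[OF \<chi>])
    qed
  qed
qed

theorem cut:
  assumes "\<Gamma> \<turnstile> \<chi>" "\<And>\<gamma>. \<gamma> \<in> \<Gamma> \<Longrightarrow> G \<turnstile> \<gamma>"
  shows "G \<turnstile> \<chi>"
proof -
  obtain F where F: "F \<subseteq> \<Gamma>" "finite F" "F \<turnstile> \<chi>" using deriv_finite[OF assms(1)] by blast
  show ?thesis
  proof (rule finite_cut[OF F(2,3)])
    show "G \<turnstile> \<gamma>" if "\<gamma> \<in> F" for \<gamma> using assms(2) that F(1) by (simp add: subset_iff)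
  qed
qed

lemma deriv_classical:
  assumes "\<And>\<delta>. \<delta> \<in> \<Delta> \<Longrightarrow> \<Gamma> \<turnstile> emb \<delta>"
    and "\<And>v. \<forall>\<delta>\<in>\<Delta>. ceval (val v) \<delta> \<Longrightarrow> ceval (val v) \<alpha>"
  shows "\<Gamma> \<turnstile> emb \<alpha>"
proof (rule cut)
  show "emb ` \<Delta> \<turnstile> emb \<alpha>" using assms(2) by (rule classical_completeness)
qed (use assms(1) in auto)

section \<open>Characteristic formulas of teams\<close>

lemma cut_insert: "\<Gamma> \<turnstile> \<phi> \<Longrightarrow> \<Gamma> \<union> {\<phi>} \<turnstile> \<chi> \<Longrightarrow> \<Gamma> \<turnstile> \<chi>"
proof (rule cut)
  show "\<Gamma> \<turnstile> \<gamma>" if "\<Gamma> \<turnstile> \<phi>" "\<gamma> \<in> \<Gamma> \<union> {\<phi>}" for \<gamma>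
    using that deriv.Assm by blast
qed

lemma deriv_foldl_And: "\<Gamma> \<turnstile> foldl And \<phi> \<phi>s \<longleftrightarrow> \<Gamma> \<turnstile> \<phi> \<and> (\<forall>\<psi>\<in>set \<phi>s. \<Gamma> \<turnstile> \<psi>)"
proof (induction \<phi>s arbitrary: \<phi>)
  case (Cons \<psi> \<phi>s)
  have "\<Gamma> \<turnstile> And \<phi> \<psi> \<longleftrightarrow> \<Gamma> \<turnstile> \<phi> \<and> \<Gamma> \<turnstile> \<psi>"
    using deriv.AndI deriv.AndE1 deriv.AndE2 by metis
  then show ?case using Cons by simp
qed simp

lemma deriv_Conj: "(\<And>\<psi>. \<psi> \<in> set \<phi>s \<Longrightarrow> \<Gamma> \<turnstile> \<psi>) \<Longrightarrow> \<Gamma> \<turnstile> Conj \<phi>s"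
  by (cases \<phi>s) (simp_all add: deriv.TopI deriv_foldl_And)

definition row_disj :: "'p list \<Rightarrow> bool list list \<Rightarrow> 'p classical" where
  "row_disj ps xs = foldr COr (map (row_power ps) xs) (CAtom Bot)"

text \<open>
  For rows of the length of \<open>ps\<close>, a nonempty team satisfies this formula just in case \<open>xs\<close> lists
  its rows. The shape is that of the left disjunct in the conclusion of \<open>\<subseteq>\<^sub>0Dst\<close>.
\<close>

definition team_char :: "'p list \<Rightarrow> bool list list \<Rightarrow> 'p form" where
  "team_char ps xs = foldl And (emb (row_disj ps xs)) (map (row ps) xs)"

lemma ceval_row_disj:
  "\<forall>x\<in>set xs. length x = length ps \<Longrightarrow> ceval (val v) (row_disj ps xs) \<longleftrightarrow> map v ps \<in> set xs"
  by (induction xs) (auto simp: row_disj_def)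

lemma deriv_team_char:
  "\<Gamma> \<turnstile> team_char ps xs \<longleftrightarrow> \<Gamma> \<turnstile> emb (row_disj ps xs) \<and> (\<forall>x\<in>set xs. \<Gamma> \<turnstile> row ps x)"
  by (simp add: team_char_def deriv_foldl_And)

lemma sat_team_char:
  assumes "set xs = (\<lambda>v. map v ps) ` X"
  shows "X \<Turnstile> team_char ps xs"
proof -
  have len: "\<forall>x\<in>set xs. length x = length ps" using assms by auto
  have "X \<Turnstile> row ps x" if "x \<in> set xs" for x
  proof -
    have "x \<in> (\<lambda>v. map v ps) ` X" using that assms by simp
    then obtain u where "u \<in> X" "x = map u ps" by blast
    then show ?thesis by (simp add: sat_incl comp_def del: sat.simps) blast
  qed
  then show ?thesis
    using assms len by (auto simp: team_char_def sat_foldl_And sat_emb ceval_row_disj simp del: sat.simps)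
qed

lemma ceval_agree:
  assumes "map u ps = map v ps" "catoms \<alpha> \<subseteq> PVar ` set ps \<union> {Top, Bot}"
  shows "ceval (val u) \<alpha> = ceval (val v) \<alpha>"
  using assms by (intro ceval_cong) auto

lemma val_agree:
  assumes "map u ps = map v ps" "a \<in> PVar ` set ps \<union> {Top, Bot}"
  shows "val u a = val v a"
  using assms by auto

lemma team_char_classical:
  assumes xs: "set xs = (\<lambda>v. map v ps) ` X" and \<Gamma>: "\<Gamma> \<turnstile> team_char ps xs"
    and \<alpha>: "\<And>u v. u \<in> X \<Longrightarrow> map u ps = map v ps \<Longrightarrow> ceval (val v) \<alpha>"
  shows "\<Gamma> \<turnstile> emb \<alpha>"
proof (rule deriv_classical)
  show "\<Gamma> \<turnstile> emb \<delta>" if "\<delta> \<in> {row_disj ps xs}" for \<delta>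
    using \<Gamma> that by (simp add: deriv_team_char)
next
  fix v assume "\<forall>\<delta>\<in>{row_disj ps xs}. ceval (val v) \<delta>"
  then have "map v ps \<in> set xs" using xs by (simp add: ceval_row_disj)
  then obtain u where "u \<in> X" "map u ps = map v ps" using xs by auto
  then show "ceval (val v) \<alpha>" by (rule \<alpha>)
qed

lemma team_char_row:
  assumes "set xs = (\<lambda>v. map v ps) ` X" "\<Gamma> \<turnstile> team_char ps xs" "v \<in> X"
  shows "\<Gamma> \<turnstile> row ps (map v ps)"
  using assms by (simp add: deriv_team_char)

lemma emb_foldl_COr: "emb (foldl COr \<alpha> \<alpha>s) = foldl Or (emb \<alpha>) (map emb \<alpha>s)"
  by (induction \<alpha>s arbitrary: \<alpha>) auto

lemma ceval_foldl_COr: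
  "ceval f (foldl COr \<alpha> \<alpha>s) \<longleftrightarrow> ceval f \<alpha> \<or> (\<exists>\<beta>\<in>set \<alpha>s. ceval f \<beta>)"
  by (induction \<alpha>s arbitrary: \<alpha>) auto

text \<open>
  \<open>\<subseteq>\<^sub>0Dst\<close> moves inclusion atoms that hold globally into one disjunct. The disjuncts \<open>ps\<^sup>y\<close> that it adds
  are absorbed, since each \<open>y\<close> is a row of \<open>ys\<close>.
\<close>

lemma or_team_charI:
  assumes len: "\<forall>y\<in>set ys. length y = length ps"
    and or: "\<Gamma> \<turnstile> Or (emb (row_disj ps ys)) \<psi>" and rows: "\<And>y. y \<in> set ys \<Longrightarrow> \<Gamma> \<turnstile> row ps y"
  shows "\<Gamma> \<turnstile> Or (team_char ps ys) \<psi>"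
proof -
  let ?xas = "map (\<lambda>y. (y, map PVar ps)) ys"
  let ?\<alpha> = "foldl COr (row_disj ps ys) (map (row_power ps) ys)"
  let ?\<theta> = "foldl And (foldl Or (emb (row_disj ps ys)) (map (\<lambda>(x, a). emb (seq_power a x)) ?xas))
          (map (\<lambda>(x, a). consts_of x \<sqsubseteq> a) ?xas)"
  have "\<Gamma> \<turnstile> Or ?\<theta> \<psi>"
    by (rule deriv.Incl0Dst[OF _ or]) (use len rows in auto)
  moreover have eq: "?\<theta> = foldl And (emb ?\<alpha>) (map (row ps) ys)"
    by (simp add: emb_foldl_COr comp_def)
  have "{?\<theta>} \<turnstile> team_char ps ys"
  proof -
    have "{?\<theta>} \<turnstile> foldl And (emb ?\<alpha>) (map (row ps) ys)"
      unfolding eq by (simp add: deriv.Assm)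
    then have 1: "{?\<theta>} \<turnstile> emb ?\<alpha>" and 2: "\<forall>y\<in>set ys. {?\<theta>} \<turnstile> row ps y"
      unfolding deriv_foldl_And by auto
    have "{?\<theta>} \<turnstile> emb (row_disj ps ys)"
    proof (rule deriv_classical)
      show "{?\<theta>} \<turnstile> emb \<delta>" if "\<delta> \<in> {?\<alpha>}" for \<delta> using 1 that by blast
      show "ceval (val v) (row_disj ps ys)" if "\<forall>\<delta>\<in>{?\<alpha>}. ceval (val v) \<delta>" for v
        using that len by (auto simp: ceval_foldl_COr ceval_row_disj)
    qed
    then show ?thesis using 2 unfolding deriv_team_char by blast
  qed
  ultimately show ?thesis by (rule or_mono) (simp add: deriv.Assm)
qed

lemma or_commute: "\<Gamma> \<turnstile> Or \<phi> \<psi> \<Longrightarrow> \<Gamma> \<turnstile> Or \<psi> \<phi>"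
  using deriv.OrE[of \<Gamma> \<phi> \<psi> "{}" "Or \<psi> \<phi>"] by (simp add: deriv.OrI1 deriv.OrI2 deriv.Assm)

lemma vars_Incl: "vars (Incl qs) = (\<Union>(a, b)\<in>set qs. set_atom a \<union> set_atom b)"
  by (induction qs) (auto simp: prod_set_defs)

lemma atom_in: "set_atom a \<subseteq> V \<Longrightarrow> a \<in> PVar ` V \<union> {Top, Bot}"
  by (cases a) auto

text \<open>
  By \<open>\<subseteq>Ext\<close> it suffices to treat each value \<open>x\<close> of the left-hand side. If \<open>X\<close> attains \<open>x\<close> there,
  some \<open>u \<in> X\<close> attains it on the right-hand side, and the row of \<open>u\<close>, extended by
  constants, contains the pairs of \<open>x \<subseteq> b\<close>. Otherwise the disjunction of the rows excludes \<open>x\<close> classically.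
\<close>

lemma team_char_incl:
  assumes xs: "set xs = (\<lambda>v. map v ps) ` X" and sat: "X \<Turnstile> Incl qs" and \<Gamma>: "\<Gamma> \<turnstile> team_char ps xs"
    and atoms: "\<forall>(a, b)\<in>set qs. {a, b} \<subseteq> PVar ` set ps \<union> {Top, Bot}"
  shows "\<Gamma> \<turnstile> Incl qs"
proof -
  let ?a = "map fst qs" and ?b = "map snd qs"
  have a: "set ?a \<subseteq> PVar ` set ps \<union> {Top, Bot}" and b: "set ?b \<subseteq> PVar ` set ps \<union> {Top, Bot}"
    using atoms by auto
  have "\<Gamma> \<turnstile> Imp (seq_power ?a x) (consts_of x \<sqsubseteq> ?b)" if len: "length x = length ?a" for x
  proof (cases "\<exists>v\<in>X. map (val v) ?a = x")
    case True
    then obtain u where u: "u \<in> X" "x = map (val u) ?b" using sat by auto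
    let ?qs = "(Top, Top) # (Bot, Bot) # zip (consts_of (map u ps)) (map PVar ps)"
    have "\<Gamma> \<turnstile> Incl ?qs"
      using team_char_row[OF xs \<Gamma> u(1)] by (rule deriv_incl_consts)
    moreover have "set (zip (consts_of x) ?b) \<subseteq> set ?qs"
    proof -
      have zipc: "zip (consts_of (map (val u) c)) c = map (\<lambda>a. (if val u a then Top else Bot, a)) c" for c
        unfolding consts_of_def by (induction c) auto
      then have "set (zip (consts_of x) ?b) = (\<lambda>a. (if val u a then Top else Bot, a)) ` set ?b"
        by (simp only: u(2) zipc set_map)
      also have "\<dots> \<subseteq> set ?qs" using b unfolding zip_row by fastforce
      finally show ?thesis .
    qed
    ultimately have "\<Gamma> \<turnstile> consts_of x \<sqsubseteq> ?b" by (rule deriv_incl_subset)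
    then show ?thesis unfolding Imp_def by (rule deriv.OrI2)
  next
    case False
    have "\<Gamma> \<turnstile> emb (CNeg (seq_power ?a x))"
    proof (rule team_char_classical[OF xs \<Gamma>])
      fix u v assume "u \<in> X" and uv: "map u ps = map v ps"
      have "map (val v) ?a = map (val u) ?a"
        unfolding map_eq_conv using a val_agree[OF uv] by (metis subsetD)
      then have "map (val v) ?a \<noteq> x" using False \<open>u \<in> X\<close> by metis
      then show "ceval (val v) (CNeg (seq_power ?a x))" using len by (simp add: ceval_seq_power)
    qed
    then show ?thesis unfolding Imp_def by (intro deriv.OrI1) simp
  qed
  then have "\<Gamma> \<turnstile> Conj (map (\<lambda>x. Imp (seq_power ?a x) (consts_of x \<sqsubseteq> ?b))
      (List.n_lists (length ?a) [True, False]))"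
    by (intro deriv_Conj) (auto simp: set_n_lists_bool)
  then have "\<Gamma> \<turnstile> ?a \<sqsubseteq> ?b" by (intro deriv.InclExt) simp_all
  then show ?thesis by (simp add: zip_map_fst_snd)
qed

lemma rows_list:
  assumes "A \<subseteq> {x :: bool list. length x = n}"
  shows "\<exists>xs. set xs = A"
proof -
  have "finite {x :: bool list. length x = n}"
    unfolding set_n_lists_bool[symmetric] by (rule finite_set)
  then have "finite A" using assms by (rule rev_finite_subset)
  then show ?thesis by (rule finite_list)
qed

lemma team_rows_list: "\<exists>xs. set xs = (\<lambda>v. map v ps) ` (X :: ('p \<Rightarrow> bool) set)"
  by (rule rows_list[where n = "length ps"]) auto

text \<open>
  For a disjunction \<open>\<psi>\<^sub>1 \<or> \<psi>\<^sub>2\<close>, split \<open>X\<close> into \<open>Y\<close> and \<open>Z\<close>. The disjunction of the rows of \<open>X\<close>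
  classically splits in the same way, and \<open>or_team_charI\<close> turns each side into a
  characteristic formula, to which the induction hypothesis applies.
\<close>

theorem team_char_complete:
  assumes "set xs = (\<lambda>v. map v ps) ` X" "X \<Turnstile> \<psi>" "vars \<psi> \<subseteq> set ps"
  shows "{team_char ps xs} \<turnstile> \<psi>"
  using assms
proof (induction \<psi> arbitrary: X xs)
  case (Atom a)
  let ?\<Gamma> = "{team_char ps xs}"
  have "?\<Gamma> \<turnstile> emb (CAtom a)"
  proof (rule team_char_classical[OF Atom.prems(1)])
    fix u v assume uv: "u \<in> X" "map u ps = map v ps"
    have "catoms (CAtom a) \<subseteq> PVar ` set ps \<union> {Top, Bot}"
      using Atom.prems(3) by (intro catoms_subset) simp
    moreover have "ceval (val u) (CAtom a)" using uv(1) Atom.prems(2) sat_emb[of X "CAtom a"] by auto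
    ultimately show "ceval (val v) (CAtom a)" using ceval_agree[OF uv(2)] by blast
  qed (simp add: deriv.Assm)
  then show ?case by simp
next
  case (Neg \<alpha>)
  let ?\<Gamma> = "{team_char ps xs}"
  have "?\<Gamma> \<turnstile> emb (CNeg \<alpha>)"
  proof (rule team_char_classical[OF Neg.prems(1)])
    fix u v assume uv: "u \<in> X" "map u ps = map v ps"
    have "catoms (CNeg \<alpha>) \<subseteq> PVar ` set ps \<union> {Top, Bot}"
      using Neg.prems(3) by (intro catoms_subset) simp
    moreover have "ceval (val u) (CNeg \<alpha>)" using uv(1) Neg.prems(2) sat_emb[of X "CNeg \<alpha>"] by auto
    ultimately show "ceval (val v) (CNeg \<alpha>)" using ceval_agree[OF uv(2)] by blast
  qed (simp add: deriv.Assm)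
  then show ?case by simp
next
  case (Incl qs)
  have "a \<in> PVar ` set ps \<union> {Top, Bot}" "b \<in> PVar ` set ps \<union> {Top, Bot}"
    if "(a, b) \<in> set qs" for a b
    using that Incl.prems(3) unfolding vars_Incl by (intro atom_in; blast)+
  then have "\<forall>(a, b)\<in>set qs. {a, b} \<subseteq> PVar ` set ps \<union> {Top, Bot}" by blast
  then show ?case by (rule team_char_incl[OF Incl.prems(1,2) deriv.Assm[OF singletonI]])
next
  case (And \<psi>1 \<psi>2)
  then have "vars \<psi>1 \<subseteq> set ps" "vars \<psi>2 \<subseteq> set ps" "X \<Turnstile> \<psi>1" "X \<Turnstile> \<psi>2" by simp_all
  then show ?case using And.IH And.prems(1) deriv.AndI by blast
next
  case (Or \<psi>1 \<psi>2)
  let ?\<Gamma> = "{team_char ps xs}"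
  have \<Gamma>: "?\<Gamma> \<turnstile> team_char ps xs" by (simp add: deriv.Assm)
  from Or.prems(2) obtain Y Z where YZ: "X = Y \<union> Z" "Y \<Turnstile> \<psi>1" "Z \<Turnstile> \<psi>2"
    unfolding sat.simps(6) by blast
  obtain ys where ys: "set ys = (\<lambda>v. map v ps) ` Y"
    using team_rows_list by blast
  obtain zs where zs: "set zs = (\<lambda>v. map v ps) ` Z"
    using team_rows_list by blast
  have len: "\<forall>y\<in>set ys. length y = length ps" "\<forall>y\<in>set zs. length y = length ps"
    unfolding ys zs by auto
  have un: "set ys \<union> set zs = set xs"
    by (simp add: ys zs Or.prems(1) YZ(1) image_Un)
  have rows: "?\<Gamma> \<turnstile> row ps y" if "y \<in> set ys \<union> set zs" for y
    using \<Gamma> that unfolding deriv_team_char un by simp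
  have "?\<Gamma> \<turnstile> emb (COr (row_disj ps ys) (row_disj ps zs))"
  proof (rule team_char_classical[OF Or.prems(1) \<Gamma>])
    fix u v assume "u \<in> X" "map u ps = map v ps"
    then have "map v ps \<in> set ys \<union> set zs" unfolding un Or.prems(1) by (metis imageI)
    then show "ceval (val v) (COr (row_disj ps ys) (row_disj ps zs))"
      using len by (simp add: ceval_row_disj)
  qed
  then have "?\<Gamma> \<turnstile> Or (emb (row_disj ps ys)) (emb (row_disj ps zs))" by simp
  from or_team_charI[OF len(1) this] rows
  have "?\<Gamma> \<turnstile> Or (team_char ps ys) (emb (row_disj ps zs))" by simp
  then have "?\<Gamma> \<turnstile> Or (emb (row_disj ps zs)) (team_char ps ys)" by (rule or_commute)
  from or_team_charI[OF len(2) this] rows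
  have "?\<Gamma> \<turnstile> Or (team_char ps zs) (team_char ps ys)" by simp
  then have "?\<Gamma> \<turnstile> Or (team_char ps ys) (team_char ps zs)" by (rule or_commute)
  moreover have "vars \<psi>1 \<subseteq> set ps" "vars \<psi>2 \<subseteq> set ps" using Or.prems(3) by simp_all
  ultimately show ?case
    using or_mono Or.IH(1)[OF ys YZ(2)] Or.IH(2)[OF zs YZ(3)] by blast
qed

text \<open>
  Locality comes for free: two teams with the same rows satisfy the same characteristic formula,
  which derives \<open>\<psi>\<close>.
\<close>

corollary sat_local:
  assumes "(\<lambda>v. map v ps) ` X = (\<lambda>v. map v ps) ` Y" "vars \<psi> \<subseteq> set ps" "X \<Turnstile> \<psi>"
  shows "Y \<Turnstile> \<psi>"
proof -
  obtain xs where xs: "set xs = (\<lambda>v. map v ps) ` X"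
    using team_rows_list by blast
  from team_char_complete[OF this assms(3,2)] show ?thesis
    by (rule soundness) (use xs assms(1) in \<open>simp add: sat_team_char\<close>)
qed

section \<open>Refuting formulas that fail in a team\<close>

lemma catoms_foldl_CAnd: "catoms (foldl CAnd \<alpha> \<alpha>s) = catoms \<alpha> \<union> \<Union>(catoms ` set \<alpha>s)"
  by (induction \<alpha>s arbitrary: \<alpha>) auto

lemma catoms_literal: "catoms (literal a x) \<subseteq> {a, Top, Bot}"
  by (cases "(a, x)" rule: literal.cases) auto

lemma catoms_row_power: "catoms (row_power ps x) \<subseteq> PVar ` set ps \<union> {Top, Bot}"
proof -
  have "catoms (CConj \<alpha>s) \<subseteq> insert Top (\<Union>(catoms ` set \<alpha>s))" for \<alpha>s :: "'a classical list"
    by (cases \<alpha>s) (auto simp: catoms_foldl_CAnd)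
  moreover have "catoms (literal a b) \<subseteq> PVar ` set ps \<union> {Top, Bot}"
    if "(a, b) \<in> set (zip (map PVar ps) x)" for a b
    using catoms_literal[of a b] set_zip_leftD[OF that] by auto
  ultimately show ?thesis unfolding seq_power_def by fastforce
qed

lemma realise_row:
  assumes "distinct ps" "length x = length ps"
  shows "\<exists>v. map v ps = x"
proof
  show "map (\<lambda>p. the (map_of (zip ps x) p)) ps = x"
    using assms by (intro nth_equalityI) (simp_all add: map_of_zip_nth)
qed

text \<open>
  Distinctness of \<open>ps\<close> ensures that every sequence of values is the row of some valuation.
\<close>

lemma row_absent:
  assumes "distinct ps" "length x = length ps" "\<Gamma> \<turnstile> row ps x" "\<Gamma> \<turnstile> Neg (row_power ps x)"
  shows "\<Gamma> \<turnstile> \<chi>"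
proof -
  obtain v where v: "map v ps = x" using realise_row[OF assms(1,2)] by blast
  show ?thesis
  proof (rule deriv_row_refute)
    show "\<Gamma> \<turnstile> row ps (map v ps)" unfolding v by (rule assms(3))
    show "\<Gamma> \<turnstile> emb (CNeg (row_power ps x))" using assms(4) by simp
    show "catoms (CNeg (row_power ps x)) \<subseteq> PVar ` set ps \<union> {Top, Bot}"
      using catoms_row_power[of ps x] by simp
    show "\<not> ceval (val v) (CNeg (row_power ps x))" using assms(2) v by simp
  qed
qed

fun Disj :: "'p form list \<Rightarrow> 'p form" where
  "Disj [] = Atom Bot"
| "Disj (\<phi> # \<phi>s) = Or \<phi> (Disj \<phi>s)"

lemma DisjI: "\<Gamma> \<turnstile> \<phi> \<Longrightarrow> \<phi> \<in> set \<phi>s \<Longrightarrow> \<Gamma> \<turnstile> Disj \<phi>s"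
  by (induction \<phi>s) (auto intro: deriv.OrI1 deriv.OrI2)

lemma or_elim: "\<lbrakk>\<Gamma> \<turnstile> Or \<phi> \<psi>; {\<phi>} \<turnstile> \<chi>; {\<psi>} \<turnstile> \<chi>\<rbrakk> \<Longrightarrow> \<Gamma> \<turnstile> \<chi>"
  using deriv.OrE[of \<Gamma> \<phi> \<psi> "{}" \<chi>] by simp

lemma DisjE: "(\<And>\<phi>. \<phi> \<in> set \<phi>s \<Longrightarrow> {\<phi>} \<turnstile> \<chi>) \<Longrightarrow> {Disj \<phi>s} \<turnstile> \<chi>"
proof (induction \<phi>s)
  case Nil
  have "{Atom Bot} \<turnstile> Atom Bot" by (simp add: deriv.Assm)
  then show ?case using explosion by simp
next
  case (Cons \<phi> \<phi>s)
  have "{Disj (\<phi> # \<phi>s)} \<turnstile> Or \<phi> (Disj \<phi>s)" by (simp add: deriv.Assm)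
  then show ?case by (rule or_elim) (use Cons in simp_all)
qed

lemma or_assoc: "\<Gamma> \<turnstile> Or \<phi> (Or \<psi> \<theta>) \<Longrightarrow> \<Gamma> \<turnstile> Or (Or \<phi> \<psi>) \<theta>"
proof (erule or_elim)
  show "{\<phi>} \<turnstile> Or (Or \<phi> \<psi>) \<theta>" by (simp add: deriv.Assm deriv.OrI1)
  have "{Or \<psi> \<theta>} \<turnstile> Or \<psi> \<theta>" by (simp add: deriv.Assm)
  then show "{Or \<psi> \<theta>} \<turnstile> Or (Or \<phi> \<psi>) \<theta>"
    by (rule or_mono) (simp_all add: deriv.Assm deriv.OrI2)
qed

lemma or_left_commute: "\<Gamma> \<turnstile> Or \<phi> (Or \<psi> \<theta>) \<Longrightarrow> \<Gamma> \<turnstile> Or \<psi> (Or \<phi> \<theta>)"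
proof (erule or_elim)
  show "{\<phi>} \<turnstile> Or \<psi> (Or \<phi> \<theta>)" by (simp add: deriv.Assm deriv.OrI1 deriv.OrI2)
  have "{Or \<psi> \<theta>} \<turnstile> Or \<psi> \<theta>" by (simp add: deriv.Assm)
  then show "{Or \<psi> \<theta>} \<turnstile> Or \<psi> (Or \<phi> \<theta>)"
    by (rule or_mono) (simp_all add: deriv.Assm deriv.OrI2)
qed

text \<open>
  In a disjunction of \<open>\<theta> \<and> x\<^sub>1 \<subseteq> ps \<and> \<dots> \<and> x\<^sub>n \<subseteq> ps\<close> with \<open>\<psi>\<close>, either the left
  part of the team is empty, or its inclusion atoms hold in the whole team. Each use of \<open>\<or>\<^sub>\<subseteq>\<^sub>0E\<close> extracts one of them.
\<close>

lemma or_rows_elim: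
  assumes "\<forall>x\<in>set xs. length x = length ps"
    and "\<Gamma> \<turnstile> Or (foldl And \<theta> (map (row ps) xs)) \<psi>"
    and "\<Gamma> \<union> row ps ` set xs \<union> {Or \<theta> \<psi>} \<turnstile> \<chi>"
    and "\<Gamma> \<union> {\<psi>} \<turnstile> \<chi>"
  shows "\<Gamma> \<turnstile> \<chi>"
  using assms
proof (induction xs arbitrary: \<Gamma> rule: rev_induct)
  case Nil
  have "\<Gamma> \<turnstile> Or \<theta> \<psi>" using Nil.prems(2) by simp
  then show ?case by (rule cut_insert) (use Nil.prems(3) in simp)
next
  case (snoc x xs)
  let ?F = "foldl And \<theta> (map (row ps) xs)"
  have both: "\<Gamma> \<union> {Or ?F \<psi>, row ps x} \<turnstile> \<chi>"
  proof (rule snoc.IH)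
    show "\<Gamma> \<union> {Or ?F \<psi>, row ps x} \<turnstile> Or ?F \<psi>" by (simp add: deriv.Assm)
    show "\<Gamma> \<union> {Or ?F \<psi>, row ps x} \<union> row ps ` set xs \<union> {Or \<theta> \<psi>} \<turnstile> \<chi>"
      using snoc.prems(3) by (rule deriv_mono) auto
    show "\<Gamma> \<union> {Or ?F \<psi>, row ps x} \<union> {\<psi>} \<turnstile> \<chi>"
      using snoc.prems(4) by (rule deriv_mono) auto
  qed (use snoc.prems(1) in simp)
  show ?case
  proof (rule deriv.OrIncl0E[OF _ _ _ snoc.prems(4) both])
    show "length x = length (map PVar ps)" using snoc.prems(1) by simp
    show "\<Gamma> \<turnstile> Or (And ?F (row ps x)) \<psi>" using snoc.prems(2) by simp
    show "\<Gamma> \<union> {?F, row ps x} \<turnstile> \<chi>"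
    proof (rule cut[OF both])
      have "\<Gamma> \<union> {?F, row ps x} \<turnstile> Or ?F \<psi>" by (rule deriv.OrI1) (simp add: deriv.Assm)
      then show "\<Gamma> \<union> {?F, row ps x} \<turnstile> \<gamma>" if "\<gamma> \<in> \<Gamma> \<union> {Or ?F \<psi>, row ps x}" for \<gamma>
        using that by (auto simp: deriv.Assm)
    qed
  qed
qed

text \<open>
  A disjunction of characteristic formulas splits into cases according to the set \<open>S\<close> of those
  disjuncts that receive a nonempty part of the team. In each case their rows occur in the whole
  team, and what remains of the disjunction is a classical formula \<open>\<beta>\<close>. It is described only up to
  equivalence, and the disjuncts already processed are accumulated in \<open>\<alpha>\<close>.
\<close>

lemma disj_team_char_elim:
  assumes "\<forall>xs\<in>set L. \<forall>x\<in>set xs. length x = length ps"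
    and "\<Gamma> \<turnstile> Or (emb \<alpha>) (Disj (map (team_char ps) L))"
    and "\<And>S \<beta>. \<lbrakk>S \<subseteq> set L; \<And>v. ceval (val v) \<beta> \<longleftrightarrow> ceval (val v) \<alpha> \<or> (\<exists>xs\<in>S. map v ps \<in> set xs)\<rbrakk>
      \<Longrightarrow> \<Gamma> \<union> row ps ` \<Union>(set ` S) \<union> {emb \<beta>} \<turnstile> \<chi>"
  shows "\<Gamma> \<turnstile> \<chi>"
  using assms
proof (induction L arbitrary: \<alpha> \<Gamma>)
  case Nil
  have "\<Gamma> \<union> row ps ` \<Union>(set ` {}) \<union> {emb (COr \<alpha> (CAtom Bot))} \<turnstile> \<chi>"
    by (rule Nil.prems(3)) auto
  moreover have "\<Gamma> \<turnstile> emb (COr \<alpha> (CAtom Bot))" using Nil.prems(2) by simp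
  ultimately show ?case using cut_insert by simp
next
  case (Cons xs L)
  let ?D = "Disj (map (team_char ps) L)"
  have len: "\<forall>x\<in>set xs. length x = length ps" "\<forall>xs\<in>set L. \<forall>x\<in>set xs. length x = length ps"
    using Cons.prems(1) by auto
  have "\<Gamma> \<turnstile> Or (emb \<alpha>) (Or (team_char ps xs) ?D)" using Cons.prems(2) by simp
  then have main: "\<Gamma> \<turnstile> Or (team_char ps xs) (Or (emb \<alpha>) ?D)" by (rule or_left_commute)
  show ?case
  proof (rule or_rows_elim[OF len(1) main[unfolded team_char_def[of ps xs]]])
    let ?\<Gamma> = "\<Gamma> \<union> row ps ` set xs \<union> {Or (emb (row_disj ps xs)) (Or (emb \<alpha>) ?D)}"
    show "?\<Gamma> \<turnstile> \<chi>"
    proof (rule Cons.IH[OF len(2)])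
      have "?\<Gamma> \<turnstile> Or (emb (row_disj ps xs)) (Or (emb \<alpha>) ?D)" by (simp add: deriv.Assm)
      then show "?\<Gamma> \<turnstile> Or (emb (COr (row_disj ps xs) \<alpha>)) ?D" using or_assoc by simp
      fix S \<beta>
      assume S: "S \<subseteq> set L" and \<beta>: "\<And>v. ceval (val v) \<beta> \<longleftrightarrow>
        ceval (val v) (COr (row_disj ps xs) \<alpha>) \<or> (\<exists>xs\<in>S. map v ps \<in> set xs)"
      have "\<Gamma> \<union> row ps ` \<Union>(set ` insert xs S) \<union> {emb \<beta>} \<turnstile> \<chi>"
      proof (rule Cons.prems(3))
        show "insert xs S \<subseteq> set (xs # L)" using S by auto
        show "ceval (val v) \<beta> \<longleftrightarrow> ceval (val v) \<alpha> \<or> (\<exists>xs\<in>insert xs S. map v ps \<in> set xs)" for v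
          using \<beta>[of v] by (auto simp: ceval_row_disj[OF len(1)])
      qed
      then show "?\<Gamma> \<union> row ps ` \<Union>(set ` S) \<union> {emb \<beta>} \<turnstile> \<chi>"
        by (rule deriv_mono) auto
    qed
    show "\<Gamma> \<union> {Or (emb \<alpha>) ?D} \<turnstile> \<chi>"
    proof (rule Cons.IH[OF len(2)])
      show "\<Gamma> \<union> {Or (emb \<alpha>) ?D} \<turnstile> Or (emb \<alpha>) ?D" by (simp add: deriv.Assm)
      fix S \<beta>
      assume S: "S \<subseteq> set L" and \<beta>: "\<And>v. ceval (val v) \<beta> \<longleftrightarrow>
        ceval (val v) \<alpha> \<or> (\<exists>xs\<in>S. map v ps \<in> set xs)"
      have "\<Gamma> \<union> row ps ` \<Union>(set ` S) \<union> {emb \<beta>} \<turnstile> \<chi>"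
        using S by (intro Cons.prems(3) \<beta>) auto
      then show "\<Gamma> \<union> {Or (emb \<alpha>) ?D} \<union> row ps ` \<Union>(set ` S) \<union> {emb \<beta>} \<turnstile> \<chi>"
        by (rule deriv_mono) auto
    qed
  qed
qed

definition team_of :: "'p list \<Rightarrow> bool list list \<Rightarrow> ('p \<Rightarrow> bool) set" where
  "team_of ps xs = {v. map v ps \<in> set xs}"

lemma rows_team_of:
  assumes "distinct ps" "\<forall>x\<in>set xs. length x = length ps"
  shows "set xs = (\<lambda>v. map v ps) ` team_of ps xs"
proof
  show "set xs \<subseteq> (\<lambda>v. map v ps) ` team_of ps xs"
  proof
    fix x assume x: "x \<in> set xs"
    then obtain v where "map v ps = x" using realise_row assms by blast
    then show "x \<in> (\<lambda>v. map v ps) ` team_of ps xs" using x by (auto simp: team_of_def)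
  qed
qed (auto simp: team_of_def)

definition teams_sat :: "'p list \<Rightarrow> 'p form \<Rightarrow> bool list list list" where
  "teams_sat ps \<psi> =
    filter (\<lambda>xs. team_of ps xs \<Turnstile> \<psi>) (subseqs (List.n_lists (length ps) [True, False]))"

lemma teams_satD:
  assumes "xs \<in> set (teams_sat ps \<psi>)"
  shows "team_of ps xs \<Turnstile> \<psi>" "\<forall>x\<in>set xs. length x = length ps"
proof -
  have "set xs \<in> set ` set (subseqs (List.n_lists (length ps) [True, False]))"
    using assms by (auto simp: teams_sat_def)
  then have "set xs \<subseteq> {x. length x = length ps}"
    by (simp add: subseqs_powset set_n_lists_bool)
  then show "\<forall>x\<in>set xs. length x = length ps" by blast
qed (use assms in \<open>simp add: teams_sat_def\<close>)

text \<open>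
  The hypothesis on failing teams is the induction hypothesis of \<open>team_char_refute\<close>.
  It discards all cases of the distinction over teams except those where \<open>\<psi>\<close> holds.
\<close>

lemma normal_form:
  assumes "distinct ps"
    and failing: "\<And>xs. \<lbrakk>\<forall>x\<in>set xs. length x = length ps; \<not> team_of ps xs \<Turnstile> \<psi>\<rbrakk>
      \<Longrightarrow> {team_char ps xs, \<psi>} \<turnstile> Atom Bot"
  shows "{\<psi>} \<turnstile> Disj (map (team_char ps) (teams_sat ps \<psi>))"
proof (rule team_split[where ps = ps])
  fix R assume R: "R \<subseteq> {x :: bool list. length x = length ps}"
  let ?\<Gamma> = "{\<psi>} \<union> diagram ps R ({x. length x = length ps} - R)"
  let ?all = "subseqs (List.n_lists (length ps) [True, False])"
  have "R \<in> set ` set ?all" using R by (simp add: subseqs_powset set_n_lists_bool)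
  then obtain xs where xs: "R = set xs" "xs \<in> set ?all" by blast
  have len: "\<forall>x\<in>set xs. length x = length ps" using R xs(1) by blast
  have char: "?\<Gamma> \<turnstile> team_char ps xs"
    unfolding deriv_team_char
  proof
    show "?\<Gamma> \<turnstile> emb (row_disj ps xs)"
    proof (rule deriv_classical)
      let ?\<Delta> = "(\<lambda>x. CNeg (row_power ps x)) ` ({x. length x = length ps} - R)"
      show "?\<Gamma> \<turnstile> emb \<delta>" if "\<delta> \<in> ?\<Delta>" for \<delta>
        using that by (intro deriv.Assm) (auto simp: diagram_def)
      show "ceval (val v) (row_disj ps xs)" if "\<forall>\<delta>\<in>?\<Delta>. ceval (val v) \<delta>" for v
      proof -
        have "map v ps \<in> R"
        proof (rule ccontr)
          assume "map v ps \<notin> R"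
          then have "CNeg (row_power ps (map v ps)) \<in> ?\<Delta>" by (intro imageI) simp
          then have "ceval (val v) (CNeg (row_power ps (map v ps)))" using that by blast
          then show False by simp
        qed
        then show ?thesis using xs(1) by (simp add: ceval_row_disj[OF len])
      qed
    qed
    show "\<forall>x\<in>set xs. ?\<Gamma> \<turnstile> row ps x"
      using xs(1) by (intro ballI deriv.Assm) (simp add: diagram_def)
  qed
  show "?\<Gamma> \<turnstile> Disj (map (team_char ps) (teams_sat ps \<psi>))"
  proof (cases "team_of ps xs \<Turnstile> \<psi>")
    case True
    then have "team_char ps xs \<in> set (map (team_char ps) (teams_sat ps \<psi>))"
      using xs(2) by (simp add: teams_sat_def)
    with char show ?thesis by (rule DisjI)
  next
    case False
    have "?\<Gamma> \<turnstile> Atom Bot"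
    proof (rule cut[OF failing[OF len False]])
      show "?\<Gamma> \<turnstile> \<gamma>" if "\<gamma> \<in> {team_char ps xs, \<psi>}" for \<gamma>
        using that char deriv.Assm[of \<psi> ?\<Gamma>] by auto
    qed
    then show ?thesis by (rule explosion)
  qed
qed

lemma ceval_foldr_CAnd: "ceval f (foldr CAnd \<alpha>s \<beta>) \<longleftrightarrow> (\<forall>\<alpha>\<in>set \<alpha>s. ceval f \<alpha>) \<and> ceval f \<beta>"
  by (induction \<alpha>s) auto

lemma catoms_foldr_CAnd: "catoms (foldr CAnd \<alpha>s \<beta>) = \<Union>(catoms ` set \<alpha>s) \<union> catoms \<beta>"
  by (induction \<alpha>s) auto

lemma team_char_refute_classical:
  assumes xs: "set xs = (\<lambda>v. map v ps) ` X" and "\<not> X \<Turnstile> emb \<alpha>" and "vars (emb \<alpha>) \<subseteq> set ps"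
  shows "{team_char ps xs, emb \<alpha>} \<turnstile> \<chi>"
proof -
  obtain v where v: "v \<in> X" "\<not> ceval (val v) \<alpha>" using assms(2) unfolding sat_emb by blast
  show ?thesis
  proof (rule deriv_row_refute)
    show "{team_char ps xs, emb \<alpha>} \<turnstile> row ps (map v ps)"
      by (rule team_char_row[OF xs _ v(1)]) (simp add: deriv.Assm)
    show "{team_char ps xs, emb \<alpha>} \<turnstile> emb \<alpha>" by (simp add: deriv.Assm)
  qed (rule catoms_subset[OF assms(3)], rule v(2))
qed

text \<open>
  Some \<open>v \<in> X\<close> has no partner. The classical formula \<open>\<not> b\<^sup>y\<close>, for the value \<open>y\<close> of the left-hand side at
  \<open>v\<close>, then follows from the rows of \<open>X\<close>. The inclusion atom transfers it to the left-hand side, where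
  \<open>v\<close> falsifies it.
\<close>

lemma team_char_refute_incl:
  assumes xs: "set xs = (\<lambda>v. map v ps) ` X" and "\<not> X \<Turnstile> Incl qs"
    and atoms: "\<forall>(a, b)\<in>set qs. {a, b} \<subseteq> PVar ` set ps \<union> {Top, Bot}"
  shows "{team_char ps xs, Incl qs} \<turnstile> \<chi>"
proof -
  let ?\<Gamma> = "{team_char ps xs, Incl qs}"
  \<comment> \<open>The additional pairs provide an atom for the empty conjunction in \<open>\<gamma>\<close> below.\<close>
  let ?qs = "(Top, Top) # (Bot, Bot) # qs"
  have char: "?\<Gamma> \<turnstile> team_char ps xs" by (simp add: deriv.Assm)
  have incl: "?\<Gamma> \<turnstile> Incl ?qs" by (rule deriv_incl_consts) (simp add: deriv.Assm)
  obtain v where v: "v \<in> X" "\<forall>u\<in>X. map (val v) (map fst qs) \<noteq> map (val u) (map snd qs)"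
    using assms(2) unfolding sat.simps by blast
  define lit where "lit q = (if val v (fst q) then CAtom q else CNeg (CAtom q))" for q :: "'a atom \<times> 'a atom"
  have lit: "ceval f (lit q) \<longleftrightarrow> f q = val v (fst q)" "catoms (lit q) = {q}" for f q
    by (simp_all add: lit_def)
  define \<gamma> where "\<gamma> = CNeg (foldr CAnd (map lit qs) (CAtom (Top, Top)))"
  have snd: "ceval (val u) (map_cform snd \<gamma>) \<longleftrightarrow> \<not> (\<forall>q\<in>set qs. val u (snd q) = val v (fst q))" for u
    unfolding ceval_map_cform \<gamma>_def by (simp add: ceval_foldr_CAnd lit)
  have fst: "\<not> ceval (val v) (map_cform fst \<gamma>)"
    unfolding ceval_map_cform \<gamma>_def by (auto simp: ceval_foldr_CAnd lit)
  have cat: "catoms \<gamma> \<subseteq> set ?qs"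
    unfolding \<gamma>_def by (auto simp: catoms_foldr_CAnd lit)
  have "?\<Gamma> \<turnstile> emb (map_cform snd \<gamma>)"
  proof (rule team_char_classical[OF xs char])
    fix u w assume u: "u \<in> X" and uw: "map u ps = map w ps"
    have "map (val v) (map fst qs) \<noteq> map (val u) (map snd qs)" using v(2) u by blast
    then have "\<not> (\<forall>q\<in>set qs. val v (fst q) = val u (snd q))" by simp
    then obtain q where q: "q \<in> set qs" "val v (fst q) \<noteq> val u (snd q)" by blast
    have "{fst q, snd q} \<subseteq> PVar ` set ps \<union> {Top, Bot}"
      using bspec[OF atoms q(1)] by (simp only: case_prod_beta)
    then have "snd q \<in> PVar ` set ps \<union> {Top, Bot}" by simp
    then have "val u (snd q) = val w (snd q)" by (rule val_agree[OF uw])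
    then show "ceval (val w) (map_cform snd \<gamma>)" unfolding snd using q by metis
  qed
  then have "?\<Gamma> \<turnstile> emb (map_cform fst \<gamma>)" by (rule deriv_incl_transfer[OF incl cat])
  then show ?thesis
  proof (rule deriv_row_refute[OF team_char_row[OF xs char v(1)]])
    show "catoms (map_cform fst \<gamma>) \<subseteq> PVar ` set ps \<union> {Top, Bot}"
    proof -
      have "fst q \<in> PVar ` set ps \<union> {Top, Bot}" if "q \<in> set ?qs" for q
        using that atoms by (cases q) auto
      then show ?thesis unfolding cform.set_map using cat by blast
    qed
  qed (rule fst)
qed

text \<open>
  For a disjunction, bring both disjuncts into normal form and eliminate the resulting disjunction of
  characteristic formulas. The rows of the surviving teams must be exactly those of \<open>X\<close>: a row not in
  \<open>X\<close> is excluded by the characteristic formula of \<open>X\<close>, and a row of \<open>X\<close> not covered by them is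
  excluded by \<open>\<beta>\<close>. But then \<open>X\<close> is, up to locality, a union of teams satisfying one disjunct or
  the other, and so satisfies the disjunction by union closure.
\<close>

theorem team_char_refute:
  assumes "distinct ps" "set xs = (\<lambda>v. map v ps) ` X" "\<not> X \<Turnstile> \<psi>" "vars \<psi> \<subseteq> set ps"
  shows "{team_char ps xs, \<psi>} \<turnstile> Atom Bot"
  using assms(2-)
proof (induction \<psi> arbitrary: X xs)
  case (Atom a)
  then show ?case using team_char_refute_classical[of xs ps X "CAtom a"] by simp
next
  case (Neg \<alpha>)
  then show ?case using team_char_refute_classical[of xs ps X "CNeg \<alpha>"] by simp
next
  case (Incl qs)
  have "a \<in> PVar ` set ps \<union> {Top, Bot}" "b \<in> PVar ` set ps \<union> {Top, Bot}"
    if "(a, b) \<in> set qs" for a b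
    using that Incl.prems(3) unfolding vars_Incl by (intro atom_in; blast)+
  then have "\<forall>(a, b)\<in>set qs. {a, b} \<subseteq> PVar ` set ps \<union> {Top, Bot}" by blast
  then show ?case by (rule team_char_refute_incl[OF Incl.prems(1,2)])
next
  case (And \<psi>1 \<psi>2)
  let ?\<Gamma> = "{team_char ps xs, And \<psi>1 \<psi>2}"
  have and_in: "?\<Gamma> \<turnstile> And \<psi>1 \<psi>2" by (simp add: deriv.Assm)
  have cut1: "?\<Gamma> \<turnstile> Atom Bot" if "{team_char ps xs, \<psi>} \<turnstile> Atom Bot" "?\<Gamma> \<turnstile> \<psi>" for \<psi>
    using that(1)
  proof (rule cut)
    show "?\<Gamma> \<turnstile> \<gamma>" if "\<gamma> \<in> {team_char ps xs, \<psi>}" for \<gamma>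
      using that \<open>?\<Gamma> \<turnstile> \<psi>\<close> deriv.Assm[of "team_char ps xs" ?\<Gamma>] by auto
  qed
  have "\<not> X \<Turnstile> \<psi>1 \<or> \<not> X \<Turnstile> \<psi>2" using And.prems(2) by simp
  moreover have "vars \<psi>1 \<subseteq> set ps" "vars \<psi>2 \<subseteq> set ps" using And.prems(3) by simp_all
  ultimately show ?case
    using cut1 And.IH And.prems(1) deriv.AndE1[OF and_in] deriv.AndE2[OF and_in] by blast
next
  case (Or \<psi>1 \<psi>2)
  let ?\<Gamma> = "{team_char ps xs, Or \<psi>1 \<psi>2}"
  have len: "\<forall>x\<in>set xs. length x = length ps" unfolding Or.prems(1) by simp
  have v12: "vars \<psi>1 \<subseteq> set ps" "vars \<psi>2 \<subseteq> set ps" using Or.prems(3) by simp_all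
  let ?L1 = "teams_sat ps \<psi>1" and ?L2 = "teams_sat ps \<psi>2"
  have nf1: "{\<psi>1} \<turnstile> Disj (map (team_char ps) ?L1)"
  proof (rule normal_form[OF assms(1)])
    fix ys assume "\<forall>y\<in>set ys. length y = length ps" "\<not> team_of ps ys \<Turnstile> \<psi>1"
    then show "{team_char ps ys, \<psi>1} \<turnstile> Atom Bot"
      using Or.IH(1)[OF rows_team_of[OF assms(1)] _ v12(1)] by simp
  qed
  have nf2: "{\<psi>2} \<turnstile> Disj (map (team_char ps) ?L2)"
  proof (rule normal_form[OF assms(1)])
    fix ys assume "\<forall>y\<in>set ys. length y = length ps" "\<not> team_of ps ys \<Turnstile> \<psi>2"
    then show "{team_char ps ys, \<psi>2} \<turnstile> Atom Bot"
      using Or.IH(2)[OF rows_team_of[OF assms(1)] _ v12(2)] by simp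
  qed
  let ?D = "Disj (map (team_char ps) (?L1 @ ?L2))"
  have sub: "{Disj (map (team_char ps) L)} \<turnstile> ?D" if "set L \<subseteq> set (?L1 @ ?L2)" for L
  proof (rule DisjE)
    fix \<phi> assume "\<phi> \<in> set (map (team_char ps) L)"
    then have "\<phi> \<in> set (map (team_char ps) (?L1 @ ?L2))" using that by auto
    moreover have "{\<phi>} \<turnstile> \<phi>" by (simp add: deriv.Assm)
    ultimately show "{\<phi>} \<turnstile> ?D" using DisjI by blast
  qed
  have "?\<Gamma> \<turnstile> Or \<psi>1 \<psi>2" by (simp add: deriv.Assm)
  then have "?\<Gamma> \<turnstile> ?D"
  proof (rule or_elim)
    show "{\<psi>1} \<turnstile> ?D" using nf1 sub[of ?L1] by (rule cut_single) simp
    show "{\<psi>2} \<turnstile> ?D" using nf2 sub[of ?L2] by (rule cut_single) simp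
  qed
  then have "?\<Gamma> \<turnstile> Or (emb (CAtom Bot)) ?D" by (rule deriv.OrI2)
  then show ?case
  proof (rule disj_team_char_elim[rotated])
    show "\<forall>xs\<in>set (?L1 @ ?L2). \<forall>x\<in>set xs. length x = length ps"
      using teams_satD(2) by auto
    fix S \<beta>
    assume S: "S \<subseteq> set (?L1 @ ?L2)" and "\<And>v. ceval (val v) \<beta> \<longleftrightarrow>
      ceval (val v) (CAtom Bot) \<or> (\<exists>xs\<in>S. map v ps \<in> set xs)"
    then have \<beta>: "ceval (val v) \<beta> \<longleftrightarrow> map v ps \<in> \<Union>(set ` S)" for v by simp
    let ?G = "?\<Gamma> \<union> row ps ` \<Union>(set ` S) \<union> {emb \<beta>}"
    have char: "?G \<turnstile> team_char ps xs" by (simp add: deriv.Assm)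
    have lenS: "length y = length ps" if "y \<in> \<Union>(set ` S)" for y
      using that S teams_satD(2) by fastforce
    consider y where "y \<in> \<Union>(set ` S)" "y \<notin> set xs" | x where "x \<in> set xs" "x \<notin> \<Union>(set ` S)"
      | "\<Union>(set ` S) = set xs" by blast
    then show "?G \<turnstile> Atom Bot"
    proof cases
      case 1
      show ?thesis
      proof (rule row_absent[OF assms(1) lenS[OF 1(1)]])
        show "?G \<turnstile> row ps y" using 1(1) by (intro deriv.Assm) blast
        have "?G \<turnstile> emb (CNeg (row_power ps y))"
        proof (rule deriv_classical)
          show "?G \<turnstile> emb \<delta>" if "\<delta> \<in> {row_disj ps xs}" for \<delta>
            using char that by (simp add: deriv_team_char)
          show "ceval (val v) (CNeg (row_power ps y))" if "\<forall>\<delta>\<in>{row_disj ps xs}. ceval (val v) \<delta>" for v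
            using that 1(2) by (auto simp: ceval_row_disj[OF len] lenS[OF 1(1)])
        qed
        then show "?G \<turnstile> Neg (row_power ps y)" by simp
      qed
    next
      case 2
      have lx: "length x = length ps" using len 2(1) by blast
      show ?thesis
      proof (rule row_absent[OF assms(1) lx])
        show "?G \<turnstile> row ps x" using char 2(1) by (simp add: deriv_team_char)
        have "?G \<turnstile> emb (CNeg (row_power ps x))"
        proof (rule deriv_classical)
          show "?G \<turnstile> emb \<delta>" if "\<delta> \<in> {\<beta>}" for \<delta>
            using that by (simp add: deriv.Assm)
          show "ceval (val v) (CNeg (row_power ps x))" if "\<forall>\<delta>\<in>{\<beta>}. ceval (val v) \<delta>" for v
            using that \<beta> 2(2) lx by auto
        qed
        then show "?G \<turnstile> Neg (row_power ps x)" by simp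
      qed
    next
      case 3
      let ?T = "\<lambda>\<psi>. \<Union>(team_of ps ` {ys \<in> S. team_of ps ys \<Turnstile> \<psi>})"
      have "?T \<psi>1 \<union> ?T \<psi>2 \<Turnstile> Or \<psi>1 \<psi>2"
        by (intro sat_OrI sat_Union) auto
      moreover have "?T \<psi>1 \<union> ?T \<psi>2 = \<Union>(team_of ps ` S)"
        using S teams_satD(1) by fastforce
      moreover have "\<Union>(team_of ps ` S) = team_of ps xs"
        using 3 by (auto simp: team_of_def)
      ultimately have sat: "team_of ps xs \<Turnstile> Or \<psi>1 \<psi>2" by (simp only:)
      have "(\<lambda>v. map v ps) ` team_of ps xs = (\<lambda>v. map v ps) ` X"
        using rows_team_of[OF assms(1) len] Or.prems(1) by simp
      from sat_local[OF this Or.prems(3) sat] have "X \<Turnstile> Or \<psi>1 \<psi>2" .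
      then show ?thesis using Or.prems(2) by contradiction
    qed
  qed
qed

section \<open>Completeness\<close>

text \<open>
  A maximal set not deriving \<open>\<phi>\<close> describes a single team, the set of models of its classical part.
\<close>

theorem completeness:
  assumes ent: "\<And>X. (\<forall>\<gamma>\<in>\<Gamma>. X \<Turnstile> \<gamma>) \<Longrightarrow> X \<Turnstile> \<phi>"
  shows "\<Gamma> \<turnstile> \<phi>"
proof (rule ccontr)
  assume "\<not> \<Gamma> \<turnstile> \<phi>"
  moreover have "\<not> B \<turnstile> \<phi> \<longleftrightarrow> (\<forall>F\<subseteq>B. finite F \<longrightarrow> \<not> F \<turnstile> \<phi>)" for B
    using deriv_finite[of B \<phi>] deriv_mono[of _ \<phi> B] by metis
  ultimately have "\<exists>M. \<Gamma> \<subseteq> M \<and> \<not> M \<turnstile> \<phi> \<and> (\<forall>B. M \<subseteq> B \<longrightarrow> \<not> B \<turnstile> \<phi> \<longrightarrow> B = M)"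
    by (rule maximal_extension[where P = "\<lambda>B. \<not> B \<turnstile> \<phi>"])
  then obtain M where M: "\<Gamma> \<subseteq> M" "\<not> M \<turnstile> \<phi>" and max: "\<forall>B. M \<subseteq> B \<longrightarrow> \<not> B \<turnstile> \<phi> \<longrightarrow> B = M"
    by (elim exE conjE)
  have maxD: "\<theta> \<in> M" if "\<not> M \<union> {\<theta>} \<turnstile> \<phi>" for \<theta>
    using max[rule_format, of "M \<union> {\<theta>}"] that by blast
  have row_or: "row ps x \<in> M \<or> Neg (row_power ps x) \<in> M" if "length x = length ps" for ps x
    using row_split[OF that, of M \<phi>] M(2) maxD by blast
  define X where "X = {v. \<forall>\<alpha>. emb \<alpha> \<in> M \<longrightarrow> ceval (val v) \<alpha>}"
  \<comment> \<open>A row that no valuation in \<open>X\<close> has contradicts the classical part of \<open>M\<close>.\<close>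
  have absent: "Neg (row_power ps x) \<in> M"
    if ps: "distinct ps" and x: "length x = length ps" "x \<notin> (\<lambda>v. map v ps) ` X" for ps x
  proof (rule ccontr)
    assume "Neg (row_power ps x) \<notin> M"
    then have "row ps x \<in> M" using row_or[OF x(1)] by blast
    then have row: "M \<turnstile> row ps x" by (rule deriv.Assm)
    have "M \<turnstile> emb (CNeg (row_power ps x))"
    proof (rule deriv_classical)
      show "M \<turnstile> emb \<delta>" if "\<delta> \<in> {\<alpha>. emb \<alpha> \<in> M}" for \<delta> using that by (simp add: deriv.Assm)
      show "ceval (val v) (CNeg (row_power ps x))" if "\<forall>\<delta>\<in>{\<alpha>. emb \<alpha> \<in> M}. ceval (val v) \<delta>" for v
      proof -
        have "v \<in> X" using that by (simp add: X_def)
        then show ?thesis using x by auto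
      qed
    qed
    then have "M \<turnstile> Neg (row_power ps x)" by simp
    then show False using row_absent[OF ps x(1) row] M(2) by blast
  qed
  have present: "row ps (map v ps) \<in> M" if "v \<in> X" for v ps
  proof (rule ccontr)
    assume "row ps (map v ps) \<notin> M"
    then have "emb (CNeg (row_power ps (map v ps))) \<in> M" using row_or[of "map v ps" ps] by simp
    then have "ceval (val v) (CNeg (row_power ps (map v ps)))" using that unfolding X_def by blast
    then show False by simp
  qed
  have char: "M \<turnstile> team_char ps xs" if ps: "distinct ps" and xs: "set xs = (\<lambda>v. map v ps) ` X" for ps xs
    unfolding deriv_team_char
  proof
    have len: "\<forall>x\<in>set xs. length x = length ps" unfolding xs by simp
    let ?\<Delta> = "(\<lambda>x. CNeg (row_power ps x)) ` ({x. length x = length ps} - set xs)"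
    show "M \<turnstile> emb (row_disj ps xs)"
    proof (rule deriv_classical)
      show "M \<turnstile> emb \<delta>" if "\<delta> \<in> ?\<Delta>" for \<delta>
        using that absent[OF ps] unfolding xs by (intro deriv.Assm) auto
      show "ceval (val v) (row_disj ps xs)" if "\<forall>\<delta>\<in>?\<Delta>. ceval (val v) \<delta>" for v
      proof (rule ccontr)
        assume "\<not> ceval (val v) (row_disj ps xs)"
        then have "map v ps \<notin> set xs" by (simp add: ceval_row_disj[OF len])
        then have "CNeg (row_power ps (map v ps)) \<in> ?\<Delta>" by (intro imageI) simp
        then have "ceval (val v) (CNeg (row_power ps (map v ps)))" using that by blast
        then show False by simp
      qed
    qed
    show "\<forall>x\<in>set xs. M \<turnstile> row ps x" unfolding xs using present deriv.Assm by blast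
  qed
  have decide: "\<exists>ps xs. distinct ps \<and> vars \<psi> \<subseteq> set ps \<and> set xs = (\<lambda>v. map v ps) ` X" for \<psi>
  proof -
    obtain ps where "set ps = vars \<psi>" "distinct ps"
      using finite_distinct_list[OF finite_vars[of \<psi>]] by blast
    moreover obtain xs where "set xs = (\<lambda>v. map v ps) ` X" using team_rows_list by blast
    ultimately show ?thesis by blast
  qed
  have "X \<Turnstile> \<gamma>" if "\<gamma> \<in> \<Gamma>" for \<gamma>
  proof (rule ccontr)
    assume n: "\<not> X \<Turnstile> \<gamma>"
    obtain ps xs where ps: "distinct ps" "vars \<gamma> \<subseteq> set ps" "set xs = (\<lambda>v. map v ps) ` X"
      using decide by blast
    have "M \<turnstile> Atom Bot"
    proof (rule cut[OF team_char_refute[OF ps(1,3) n ps(2)]])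
      show "M \<turnstile> \<theta>" if "\<theta> \<in> {team_char ps xs, \<gamma>}" for \<theta>
        using that char[OF ps(1,3)] M(1) \<open>\<gamma> \<in> \<Gamma>\<close> deriv.Assm[of \<gamma> M] by auto
    qed
    then show False using M(2) explosion by blast
  qed
  then have X: "X \<Turnstile> \<phi>" using ent by blast
  obtain ps xs where ps: "distinct ps" "vars \<phi> \<subseteq> set ps" "set xs = (\<lambda>v. map v ps) ` X"
    using decide by blast
  have "M \<turnstile> \<phi>" using char[OF ps(1,3)] team_char_complete[OF ps(3) X ps(2)] by (rule cut_single)
  then show False using M(2) by contradiction
qed

theorem theorem4p20:
  fixes \<Gamma> :: "'p form set" and \<phi> :: "'p form"
  shows "\<Gamma> \<TTurnstile> \<phi> \<longleftrightarrow> \<Gamma> \<turnstile> \<phi>"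
proof
  assume ent: "\<Gamma> \<TTurnstile> \<phi>"
  show "\<Gamma> \<turnstile> \<phi>"
  proof (rule completeness)
    fix X assume "\<forall>\<gamma>\<in>\<Gamma>. X \<Turnstile> \<gamma>"
    moreover have "team UNIV X" by (auto simp: team_def)
    ultimately show "X \<Turnstile> \<phi>" using ent unfolding entails_def by blast
  qed
next
  assume "\<Gamma> \<turnstile> \<phi>"
  then show "\<Gamma> \<TTurnstile> \<phi>" unfolding entails_def using soundness by blast
qed

end
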